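(* Let $\mathcal{O}_0$ be an arbitrary set of closed formulas of $\Omega$, let $\varphi$ be a closed formula of $\Omega$, let $\Gamma=\mathcal{O}_0\cup\{\varphi\}$, and let $\Delta_0$ be the set of all constants occurring in formulas of $\Gamma$. Then Proponent has a winning strategy in the game starting from the position $\mathcal{C}_0=(\mathcal{O}_0,\{\varphi\},\Delta_0)$ if and only if $\mathcal{O}_0\vDash_N\varphi$.
   Context: Language: $\Omega$ is a first-order intuitionistic language with predicate symbols and constants but no function symbols; connectives $\to,\wedge,\vee,\bot$ and quantifiers $\forall,\exists$; $\neg A$ abbreviates $A\to\bot$. Kripke frames are partially ordered sets of worlds together with a nonempty-or-empty individual domain $\Delta_w$ at each world $w$, monotone along the order; a Kripke model adds an interpretation of constants and a monotone interpretation of atomic formulas, with the usual intuitionistic forcing clauses. For a class $X$ of frames, $T\vDash_X\varphi$ means: for every Kripke model based on a frame in $X$, if every formula of $T$ is true at every world of the model, then $\varphi$ is true at every world. $N$ is the class of Noetherian Kripke frames: frames with no infinite strictly increasing sequence of worlds. The game. For a set of formulas $\Gamma$ and a set $\Delta$ of objects, $\mathcal{F}(\Gamma,\Delta)$ is the set of all formulas $P[c_1,\dots,c_n]$ where $P[x_1,\dots,x_n]$ is a subformula of some formula of $\Gamma$ whose free variables are among $x_1,\dots,x_n$ and $c_i\in\Delta$. A position is a triple $\mathcal{C}=(\mathcal{O},\mathcal{P},\Delta)$ with $\mathcal{O},\mathcal{P}\subseteq\mathcal{F}(\Gamma,\Delta)$, where $\Gamma$ is fixed at the start of the game as $\mathcal{O}_0\cup\{\varphi\}$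 for the starting position $(\mathcal{O}_0,\{\varphi\},\Delta_0)$, with $\Delta_0$ the set of constants occurring in $\Gamma$. Proponent moves by adding formulas of $\mathcal{F}(\Gamma,\Delta)$ to $\mathcal{P}$. Opponent moves by first extending $\Delta$ to some $\Delta'\supseteq\Delta$ (possibly $\Delta'=\Delta$; new elements may be arbitrary new objects) and then adding formulas of $\mathcal{F}(\Gamma,\Delta')$ to $\mathcal{O}$. Truth in a position, for formulas of $\mathcal{F}(\Gamma,\Delta)$: $\mathcal{C}\nVdash\bot$; for atomic $A[c_1,\dots,c_n]$, $\mathcal{C}\Vdash A[c_1,\dots,c_n]$ iff $A[c_1,\dots,c_n]\in\mathcal{O}$; for $\star\in\{\to,\wedge,\vee\}$, $\mathcal{C}\Vdash\psi\star\chi$ iff $\psi\star\chi\in\mathcal{O}\cup\mathcal{P}$ and $(\mathcal{C}\Vdash\psi)\star(\mathcal{C}\Vdash\chi)$ holds with $\star$ read classically; for $q\in\{\forall,\exists\}$, $\mathcal{C}\Vdash qxP[x]$ iff $qxP[x]\in\mathcal{O}\cup\mathcal{P}$ and for $q$ (read classically) $\alpha\in\Delta$, $\mathcal{C}\Vdash P[\alpha]$. A formula of $\mathcal{P}$ (resp. $\mathcal{O}$) false in the current position is a mistake of Proponent (resp. Opponent). If Opponent has no mistakes but Proponent has a mistake, Proponent must move; otherwise Opponent must move. If after a player's move that same player must move again, that player loses and the game ends. If the game continues infinitely, Proponent wins.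
   Formalization: Models need only interpret the constants occurring in Γ (else ∃x(⊥→⊥) with an unused constant in Ω is a counterexample when Δ₀ is empty); worlds, individuals and new objects come from arbitrary, sufficiently large infinite sets at least as large as the language. *)

theory Defs
  imports "HOL-Library.Equipollence"
begin

section \<open>Formulas\<close>

text \<open>There are no function symbols, so a term is a variable or a constant. Formulas are
  parametric in the type \<open>'a\<close> of constants, because the positions of the game contain formulas in
  which variables have been replaced by objects. A predicate symbol is identified by its name
  together with the number of its arguments.\<close>

datatype (tm_constants: 'a) tm = Var nat | Con 'a

datatype (predicates: 'p, constants: 'a) fm =
    Bot
  | Atom 'p "'a tm list"
  | Imp "('p, 'a) fm" "('p, 'a) fm"
  | And "('p, 'a) fm" "('p, 'a) fm"
  | Or "('p, 'a) fm" "('p, 'a) fm"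
  | All nat "('p, 'a) fm"
  | Ex nat "('p, 'a) fm"

primrec tm_vars :: "'a tm \<Rightarrow> nat set" where
  "tm_vars (Var x) = {x}"
| "tm_vars (Con a) = {}"

primrec free_vars :: "('p, 'a) fm \<Rightarrow> nat set" where
  "free_vars Bot = {}"
| "free_vars (Atom p ts) = (\<Union>t\<in>set ts. tm_vars t)"
| "free_vars (Imp \<phi> \<psi>) = free_vars \<phi> \<union> free_vars \<psi>"
| "free_vars (And \<phi> \<psi>) = free_vars \<phi> \<union> free_vars \<psi>"
| "free_vars (Or \<phi> \<psi>) = free_vars \<phi> \<union> free_vars \<psi>"
| "free_vars (All x \<phi>) = free_vars \<phi> - {x}"
| "free_vars (Ex x \<phi>) = free_vars \<phi> - {x}"

definition closed_fm :: "('p, 'a) fm \<Rightarrow> bool" where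
  "closed_fm \<phi> \<longleftrightarrow> free_vars \<phi> = {}"

primrec subformulas :: "('p, 'a) fm \<Rightarrow> ('p, 'a) fm set" where
  "subformulas Bot = {Bot}"
| "subformulas (Atom p ts) = {Atom p ts}"
| "subformulas (Imp \<phi> \<psi>) = {Imp \<phi> \<psi>} \<union> subformulas \<phi> \<union> subformulas \<psi>"
| "subformulas (And \<phi> \<psi>) = {And \<phi> \<psi>} \<union> subformulas \<phi> \<union> subformulas \<psi>"
| "subformulas (Or \<phi> \<psi>) = {Or \<phi> \<psi>} \<union> subformulas \<phi> \<union> subformulas \<psi>"
| "subformulas (All x \<phi>) = {All x \<phi>} \<union> subformulas \<phi>"
| "subformulas (Ex x \<phi>) = {Ex x \<phi>} \<union> subformulas \<phi>"

text \<open>\<open>inst s \<phi>\<close> replaces every free variable \<open>x\<close> of \<open>\<phi>\<close> with \<open>s x = Some a\<close> by the constant \<open>a\<close>;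
  variables outside the domain of \<open>s\<close> are left alone. No capture can occur.\<close>

primrec inst_tm :: "(nat \<rightharpoonup> 'a) \<Rightarrow> 'a tm \<Rightarrow> 'a tm" where
  "inst_tm s (Var x) = (case s x of None \<Rightarrow> Var x | Some a \<Rightarrow> Con a)"
| "inst_tm s (Con a) = Con a"

primrec inst :: "(nat \<rightharpoonup> 'a) \<Rightarrow> ('p, 'a) fm \<Rightarrow> ('p, 'a) fm" where
  "inst s Bot = Bot"
| "inst s (Atom p ts) = Atom p (map (inst_tm s) ts)"
| "inst s (Imp \<phi> \<psi>) = Imp (inst s \<phi>) (inst s \<psi>)"
| "inst s (And \<phi> \<psi>) = And (inst s \<phi>) (inst s \<psi>)"
| "inst s (Or \<phi> \<psi>) = Or (inst s \<phi>) (inst s \<psi>)"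
| "inst s (All x \<phi>) = All x (inst (s(x := None)) \<phi>)"
| "inst s (Ex x \<phi>) = Ex x (inst (s(x := None)) \<phi>)"

primrec height :: "('p, 'a) fm \<Rightarrow> nat" where
  "height Bot = 0"
| "height (Atom p ts) = 0"
| "height (Imp \<phi> \<psi>) = Suc (height \<phi> + height \<psi>)"
| "height (And \<phi> \<psi>) = Suc (height \<phi> + height \<psi>)"
| "height (Or \<phi> \<psi>) = Suc (height \<phi> + height \<psi>)"
| "height (All x \<phi>) = Suc (height \<phi>)"
| "height (Ex x \<phi>) = Suc (height \<phi>)"

lemma height_inst [simp]: "height (inst s \<phi>) = height \<phi>"
  by (induction \<phi> arbitrary: s) simp_all


section \<open>Kripke semantics\<close>

record ('w, 'd) kframe =
  worlds :: "'w set"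
  worldord :: "('w \<times> 'w) set"
  domain :: "'w \<Rightarrow> 'd set"

definition kripke_frame :: "('w, 'd) kframe \<Rightarrow> bool" where
  "kripke_frame F \<longleftrightarrow>
     partial_order_on (worlds F) (worldord F) \<and>
     (\<forall>(w, v) \<in> worldord F. domain F w \<subseteq> domain F v)"

definition noetherian_frames :: "('w, 'd) kframe set" where
  "noetherian_frames =
     {F. kripke_frame F \<and>
         \<not> (\<exists>s :: nat \<Rightarrow> 'w. \<forall>i. (s i, s (Suc i)) \<in> worldord F \<and> s i \<noteq> s (Suc i))}"

record ('p, 'c, 'w, 'd) kmodel =
  frame_of :: "('w, 'd) kframe"
  cinterp :: "'c \<Rightarrow> 'd"
  pinterp :: "'w \<Rightarrow> 'p \<Rightarrow> 'd list \<Rightarrow> bool"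

text \<open>\<open>C\<close> is the set of constants of the language that the model interprets. Since domains may be
  empty, this set matters: as soon as a constant is interpreted, all domains are inhabited.\<close>

definition kripke_model :: "'c set \<Rightarrow> ('p, 'c, 'w, 'd) kmodel \<Rightarrow> bool" where
  "kripke_model C M \<longleftrightarrow>
     kripke_frame (frame_of M) \<and>
     (\<forall>c \<in> C. \<forall>w \<in> worlds (frame_of M). cinterp M c \<in> domain (frame_of M) w) \<and>
     (\<forall>(w, v) \<in> worldord (frame_of M). \<forall>p ds.
        set ds \<subseteq> domain (frame_of M) w \<longrightarrow> pinterp M w p ds \<longrightarrow> pinterp M v p ds)"

primrec tm_value :: "('p, 'c, 'w, 'd) kmodel \<Rightarrow> (nat \<rightharpoonup> 'd) \<Rightarrow> 'c tm \<Rightarrow> 'd" where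
  "tm_value M e (Var x) = the (e x)"
| "tm_value M e (Con c) = cinterp M c"

primrec forces ::
  "('p, 'c, 'w, 'd) kmodel \<Rightarrow> 'w \<Rightarrow> (nat \<rightharpoonup> 'd) \<Rightarrow> ('p, 'c) fm \<Rightarrow> bool" where
  "forces M w e Bot \<longleftrightarrow> False"
| "forces M w e (Atom p ts) \<longleftrightarrow> pinterp M w p (map (tm_value M e) ts)"
| "forces M w e (Imp \<phi> \<psi>) \<longleftrightarrow>
     (\<forall>v. (w, v) \<in> worldord (frame_of M) \<longrightarrow> forces M v e \<phi> \<longrightarrow> forces M v e \<psi>)"
| "forces M w e (And \<phi> \<psi>) \<longleftrightarrow> forces M w e \<phi> \<and> forces M w e \<psi>"
| "forces M w e (Or \<phi> \<psi>) \<longleftrightarrow> forces M w e \<phi> \<or> forces M w e \<psi>"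
| "forces M w e (All x \<phi>) \<longleftrightarrow>
     (\<forall>v. (w, v) \<in> worldord (frame_of M) \<longrightarrow>
        (\<forall>d \<in> domain (frame_of M) v. forces M v (e(x \<mapsto> d)) \<phi>))"
| "forces M w e (Ex x \<phi>) \<longleftrightarrow> (\<exists>d \<in> domain (frame_of M) w. forces M w (e(x \<mapsto> d)) \<phi>)"

text \<open>Semantic consequence over a class \<open>X\<close> of frames, for closed formulas; the models interpret the
  constants that occur in \<open>T\<close> or \<open>\<phi>\<close>. Worlds and individuals are drawn from the types \<open>'w\<close> and
  \<open>'d\<close>, so this captures consequence over all models only if these types are large enough
  for the language, which has to be assumed where it matters.\<close>

definition consequence ::
  "('p, 'c) fm set \<Rightarrow> ('w, 'd) kframe set \<Rightarrow> ('p, 'c) fm \<Rightarrow> bool"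
  (\<open>(_ \<Turnstile>\<^bsub>_\<^esub> _)\<close> [51, 0, 51] 50) where
  "T \<Turnstile>\<^bsub>X\<^esub> \<phi> \<longleftrightarrow>
     (\<forall>M :: ('p, 'c, 'w, 'd) kmodel.
        kripke_model (\<Union>\<psi> \<in> T \<union> {\<phi>}. constants \<psi>) M \<longrightarrow> frame_of M \<in> X \<longrightarrow>
        (\<forall>\<psi> \<in> T. \<forall>w \<in> worlds (frame_of M). forces M w Map.empty \<psi>) \<longrightarrow>
        (\<forall>w \<in> worlds (frame_of M). forces M w Map.empty \<phi>))"


section \<open>The game\<close>

text \<open>The objects of the game are the constants of the language and arbitrary further objects.\<close>

datatype ('c, 'd) obj = Const 'c | New 'd

abbreviation lift :: "('p, 'c) fm \<Rightarrow> ('p, ('c, 'd) obj) fm" where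
  "lift \<equiv> map_fm id Const"

definition instances :: "('p, 'a) fm set \<Rightarrow> 'a set \<Rightarrow> ('p, 'a) fm set" where
  "instances \<Gamma> \<Delta> =
     {inst s \<psi> | s \<psi>. (\<exists>\<gamma> \<in> \<Gamma>. \<psi> \<in> subformulas \<gamma>) \<and> free_vars \<psi> \<subseteq> dom s \<and> ran s \<subseteq> \<Delta>}"

record ('p, 'a) position =
  opp :: "('p, 'a) fm set"
  pro :: "('p, 'a) fm set"
  objs :: "'a set"

function holds :: "('p, 'a) position \<Rightarrow> ('p, 'a) fm \<Rightarrow> bool" where
  "holds C Bot \<longleftrightarrow> False"
| "holds C (Atom p ts) \<longleftrightarrow> Atom p ts \<in> opp C"
| "holds C (Imp \<phi> \<psi>) \<longleftrightarrow> Imp \<phi> \<psi> \<in> opp C \<union> pro C \<and> (holds C \<phi> \<longrightarrow> holds C \<psi>)"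
| "holds C (And \<phi> \<psi>) \<longleftrightarrow> And \<phi> \<psi> \<in> opp C \<union> pro C \<and> (holds C \<phi> \<and> holds C \<psi>)"
| "holds C (Or \<phi> \<psi>) \<longleftrightarrow> Or \<phi> \<psi> \<in> opp C \<union> pro C \<and> (holds C \<phi> \<or> holds C \<psi>)"
| "holds C (All x \<phi>) \<longleftrightarrow>
     All x \<phi> \<in> opp C \<union> pro C \<and> (\<forall>\<alpha> \<in> objs C. holds C (inst [x \<mapsto> \<alpha>] \<phi>))"
| "holds C (Ex x \<phi>) \<longleftrightarrow>
     Ex x \<phi> \<in> opp C \<union> pro C \<and> (\<exists>\<alpha> \<in> objs C. holds C (inst [x \<mapsto> \<alpha>] \<phi>))"
  by pat_completeness auto
termination
  by (relation "Wellfounded.measure (\<lambda>(C, \<phi>). height \<phi>)") auto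

datatype player = Proponent | Opponent

primrec mistakes :: "player \<Rightarrow> ('p, 'a) position \<Rightarrow> ('p, 'a) fm set" where
  "mistakes Proponent C = {\<psi> \<in> pro C. \<not> holds C \<psi>}"
| "mistakes Opponent C = {\<psi> \<in> opp C. \<not> holds C \<psi>}"

definition to_move :: "('p, 'a) position \<Rightarrow> player" where
  "to_move C =
     (if mistakes Opponent C = {} \<and> mistakes Proponent C \<noteq> {} then Proponent else Opponent)"

primrec player_move ::
  "('p, 'a) fm set \<Rightarrow> player \<Rightarrow> ('p, 'a) position \<Rightarrow> ('p, 'a) position \<Rightarrow> bool" where
  "player_move \<Gamma> Proponent C C' \<longleftrightarrow>
     opp C' = opp C \<and> objs C' = objs C \<and>
     pro C \<subseteq> pro C' \<and> pro C' \<subseteq> pro C \<union> instances \<Gamma> (objs C)"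
| "player_move \<Gamma> Opponent C C' \<longleftrightarrow>
     pro C' = pro C \<and> objs C \<subseteq> objs C' \<and>
     opp C \<subseteq> opp C' \<and> opp C' \<subseteq> opp C \<union> instances \<Gamma> (objs C')"

definition legal_move :: "('p, 'a) fm set \<Rightarrow> ('p, 'a) position \<Rightarrow> ('p, 'a) position \<Rightarrow> bool" where
  "legal_move \<Gamma> C C' \<longleftrightarrow> player_move \<Gamma> (to_move C) C C'"

text \<open>A finite play is the list of the positions reached so far. The game is over after move \<open>i\<close>
  when the player who made that move has to move again; that player has lost.\<close>

definition over_after :: "('p, 'a) position list \<Rightarrow> nat \<Rightarrow> bool" where
  "over_after h i \<longleftrightarrow> Suc i < length h \<and> to_move (h ! i) = to_move (h ! Suc i)"

definition play ::
  "('p, 'a) fm set \<Rightarrow> ('p, 'a) position \<Rightarrow> ('p, 'a) position list \<Rightarrow> bool" where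
  "play \<Gamma> C h \<longleftrightarrow>
     h \<noteq> [] \<and> hd h = C \<and>
     (\<forall>i. Suc i < length h \<longrightarrow> legal_move \<Gamma> (h ! i) (h ! Suc i)) \<and>
     (\<forall>i. Suc (Suc i) < length h \<longrightarrow> \<not> over_after h i)"

definition lost_by :: "player \<Rightarrow> ('p, 'a) position list \<Rightarrow> bool" where
  "lost_by X h \<longleftrightarrow> (\<exists>i. over_after h i \<and> to_move (h ! i) = X)"

text \<open>A strategy chooses the next position from the play so far.\<close>

definition follows ::
  "player \<Rightarrow> (('p, 'a) position list \<Rightarrow> ('p, 'a) position) \<Rightarrow> ('p, 'a) position list \<Rightarrow> bool" where
  "follows X \<sigma> h \<longleftrightarrow>
     (\<forall>i. Suc i < length h \<longrightarrow> to_move (h ! i) = X \<longrightarrow> h ! Suc i = \<sigma> (take (Suc i) h))"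

text \<open>Proponent wins the infinite plays, and a legal move always exists (adding nothing). Hence a
  strategy of Proponent wins all plays that follow it iff it prescribes legal moves and no finite
  play that follows it is lost by Proponent.\<close>

definition proponent_winning_strategy ::
  "('p, 'a) fm set \<Rightarrow> ('p, 'a) position \<Rightarrow> (('p, 'a) position list \<Rightarrow> ('p, 'a) position) \<Rightarrow> bool"
  where
  "proponent_winning_strategy \<Gamma> C \<sigma> \<longleftrightarrow>
     (\<forall>h. play \<Gamma> C h \<and> follows Proponent \<sigma> h \<longrightarrow>
        \<not> lost_by Proponent h \<and>
        (\<not> lost_by Opponent h \<and> to_move (last h) = Proponent \<longrightarrow> legal_move \<Gamma> (last h) (\<sigma> h)))"

end

theory Submission
  imports Defs
begin

text \<open>Both directions compare a position with a world of a Kripke model at which it has the same true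
  formulas.

  Given a Noetherian model refuting \<open>\<phi>\<close>, Opponent moves to a maximal world at which some formula of
  Proponent fails, and there claims everything that is forced. Then truth in the position is forcing at
  that world, so Proponent has to move; each further move of Opponent leads to a strictly
  larger world, which can happen only finitely often, so Proponent cannot win.

  If \<open>\<phi>\<close> is a consequence of \<open>O\<^sub>0\<close>, then Proponent always claims all consequences of
  Opponent's formulas. If Opponent has made no mistake, put countermodels for all
  non-consequences side by side above a new root whose domain is the set of objects and whose atoms are
  those claimed by Opponent. Truth in the position is forcing at the root, the glued model is a
  Noetherian model of Opponent's formulas, and therefore Proponent has made no mistake either.\<close>

section \<open>Instances of subformulas\<close>

text \<open>Forcing of implications and universal formulas looks at all later worlds, truth in a
  position only at the present one. Agreement at the root is obtained before it is known that the
  root forces Opponent's claims; this comes only from the absence of mistakes, and only then is the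
  glued model a model of these claims, so that every consequence of them must hold at the root.
  Noetherian frames provide maximal refuting worlds and make Opponent's ascent stop; a new root
  lengthens a chain by at most one step. As worlds and individuals come from fixed types, the glued
  model, indexed by formulas, has to be copied back into these types, and the cardinality
  assumptions make room for it.\<close>

lemma subformulas_refl: "\<psi> \<in> subformulas \<psi>"
  by (cases \<psi>) auto

lemma subformulas_trans: "\<chi> \<in> subformulas \<psi> \<Longrightarrow> \<psi> \<in> subformulas \<gamma> \<Longrightarrow> \<chi> \<in> subformulas \<gamma>"
  by (induction \<gamma>) auto

lemma constants_subformula: "\<psi> \<in> subformulas \<gamma> \<Longrightarrow> constants \<psi> \<subseteq> constants \<gamma>"
  by (induction \<gamma>) auto

lemma constants_inst_tm: "tm_constants (inst_tm s t) \<subseteq> tm_constants t \<union> ran s"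
  by (cases t) (auto simp: ran_def split: option.splits)

lemma constants_inst: "constants (inst s \<psi>) \<subseteq> constants \<psi> \<union> ran s"
proof (induction \<psi> arbitrary: s)
  case (Atom p ts)
  then show ?case using constants_inst_tm[of s] by fastforce
next
  case (All x \<psi>)
  have "ran (s(x := None)) \<subseteq> ran s" by (auto simp: ran_def)
  with All[of "s(x := None)"] show ?case by (simp del: fun_upd_apply) blast
next
  case (Ex x \<psi>)
  have "ran (s(x := None)) \<subseteq> ran s" by (auto simp: ran_def)
  with Ex[of "s(x := None)"] show ?case by (simp del: fun_upd_apply) blast
qed (simp_all, blast+)

lemma free_vars_inst_tm: "tm_vars (inst_tm s t) = tm_vars t - dom s"
  by (cases t) (auto split: option.splits)

lemma free_vars_inst: "free_vars (inst s \<psi>) = free_vars \<psi> - dom s"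
  by (induction \<psi> arbitrary: s) (auto simp: free_vars_inst_tm)

lemma inst_tm_inst_tm: "inst_tm t (inst_tm s u) = inst_tm (t ++ s) u"
  by (cases u) (auto simp: map_add_def split: option.splits)

lemma map_add_upd_None: "t(x := None) ++ s(x := None) = (t ++ s)(x := None)"
  by (rule ext) (simp add: map_add_def split: option.split)

text \<open>Variables replaced by \<open>s\<close> are gone when \<open>t\<close> acts, so on a
  common variable \<open>s\<close> wins, which is the priority that \<open>++\<close> gives to its
  right argument.\<close>

lemma inst_inst: "inst t (inst s \<psi>) = inst (t ++ s) \<psi>"
  by (induction \<psi> arbitrary: s t)
    (simp_all add: inst_tm_inst_tm map_add_upd_None del: fun_upd_apply)

lemma inst_tm_disjoint: "tm_vars t \<inter> dom s = {} \<Longrightarrow> inst_tm s t = t"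
  by (cases t) (auto split: option.splits)

lemma inst_disjoint: "free_vars \<psi> \<inter> dom s = {} \<Longrightarrow> inst s \<psi> = \<psi>"
proof (induction \<psi> arbitrary: s)
  case (Atom p ts)
  then show ?case by (auto intro!: map_idI inst_tm_disjoint)
next
  case (All x \<psi>)
  have "inst (s(x := None)) \<psi> = \<psi>" by (rule All.IH) (use All.prems in \<open>auto split: if_splits\<close>)
  then show ?case by simp
next
  case (Ex x \<psi>)
  have "inst (s(x := None)) \<psi> = \<psi>" by (rule Ex.IH) (use Ex.prems in \<open>auto split: if_splits\<close>)
  then show ?case by simp
qed (simp_all add: Int_Un_distrib2)

lemma instancesI:
  "\<gamma> \<in> \<Gamma> \<Longrightarrow> \<psi> \<in> subformulas \<gamma> \<Longrightarrow> free_vars \<psi> \<subseteq> dom s \<Longrightarrow> ran s \<subseteq> \<Delta> \<Longrightarrow>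
    inst s \<psi> \<in> instances \<Gamma> \<Delta>"
  unfolding instances_def by blast

lemma instancesE:
  assumes "\<psi> \<in> instances \<Gamma> \<Delta>"
  obtains s \<chi> \<gamma> where "\<psi> = inst s \<chi>" "\<gamma> \<in> \<Gamma>" "\<chi> \<in> subformulas \<gamma>" "free_vars \<chi> \<subseteq> dom s" "ran s \<subseteq> \<Delta>"
  using assms unfolding instances_def by blast

lemma instances_mono: "\<Delta> \<subseteq> \<Delta>' \<Longrightarrow> instances \<Gamma> \<Delta> \<subseteq> instances \<Gamma> \<Delta>'"
  unfolding instances_def by blast

lemma closed_in_instances:
  assumes "\<gamma> \<in> \<Gamma>" "closed_fm \<gamma>"
  shows "\<gamma> \<in> instances \<Gamma> \<Delta>"
proof -
  have "inst Map.empty \<gamma> \<in> instances \<Gamma> \<Delta>"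
    by (rule instancesI[OF assms(1) subformulas_refl]) (use assms(2) in \<open>simp_all add: closed_fm_def\<close>)
  then show ?thesis by (simp add: inst_disjoint)
qed

lemma closed_instances: "\<psi> \<in> instances \<Gamma> \<Delta> \<Longrightarrow> free_vars \<psi> = {}"
  by (auto simp: instances_def free_vars_inst)

lemma constants_instances:
  assumes "\<psi> \<in> instances \<Gamma> \<Delta>"
  shows "constants \<psi> \<subseteq> (\<Union>\<gamma>\<in>\<Gamma>. constants \<gamma>) \<union> \<Delta>"
proof -
  obtain s \<chi> \<gamma> where "\<psi> = inst s \<chi>" "\<gamma> \<in> \<Gamma>" "\<chi> \<in> subformulas \<gamma>" "ran s \<subseteq> \<Delta>"
    using assms by (rule instancesE)
  then show ?thesis
    using constants_inst[of s \<chi>] constants_subformula[of \<chi> \<gamma>] by blast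
qed

text \<open>The same substitution serves the part, since it covers the free variables of the part as
  well. Below a quantifier a new variable becomes free, so that case is treated separately.\<close>

lemma instances_part:
  assumes "\<psi> \<in> instances \<Gamma> \<Delta>"
    and "\<And>s \<chi>. \<psi> = inst s \<chi> \<Longrightarrow> \<exists>\<theta> \<in> subformulas \<chi>. free_vars \<theta> \<subseteq> free_vars \<chi> \<and> \<psi>' = inst s \<theta>"
  shows "\<psi>' \<in> instances \<Gamma> \<Delta>"
proof -
  obtain s \<chi> \<gamma> where *: "\<psi> = inst s \<chi>" "\<gamma> \<in> \<Gamma>" "\<chi> \<in> subformulas \<gamma>" "free_vars \<chi> \<subseteq> dom s" "ran s \<subseteq> \<Delta>"
    using assms(1) by (rule instancesE)
  from assms(2)[OF *(1)] obtain \<theta> where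
    "\<theta> \<in> subformulas \<chi>" "free_vars \<theta> \<subseteq> free_vars \<chi>" "\<psi>' = inst s \<theta>" by blast
  with *(2-5) show ?thesis
    using instancesI[OF *(2) subformulas_trans[OF _ *(3)], of \<theta> s] by blast
qed

lemma instances_binary:
  "Imp \<psi> \<chi> \<in> instances \<Gamma> \<Delta> \<Longrightarrow> \<psi> \<in> instances \<Gamma> \<Delta> \<and> \<chi> \<in> instances \<Gamma> \<Delta>"
  "And \<psi> \<chi> \<in> instances \<Gamma> \<Delta> \<Longrightarrow> \<psi> \<in> instances \<Gamma> \<Delta> \<and> \<chi> \<in> instances \<Gamma> \<Delta>"
  "Or \<psi> \<chi> \<in> instances \<Gamma> \<Delta> \<Longrightarrow> \<psi> \<in> instances \<Gamma> \<Delta> \<and> \<chi> \<in> instances \<Gamma> \<Delta>"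
proof -
  assume a: "Imp \<psi> \<chi> \<in> instances \<Gamma> \<Delta>"
  have "\<exists>\<theta> \<in> subformulas \<xi>. free_vars \<theta> \<subseteq> free_vars \<xi> \<and> \<psi> = inst s \<theta>"
    "\<exists>\<theta> \<in> subformulas \<xi>. free_vars \<theta> \<subseteq> free_vars \<xi> \<and> \<chi> = inst s \<theta>"
    if "Imp \<psi> \<chi> = inst s \<xi>" for s \<xi>
    using that by (cases \<xi>; auto intro: subformulas_refl)+
  with a instances_part show "\<psi> \<in> instances \<Gamma> \<Delta> \<and> \<chi> \<in> instances \<Gamma> \<Delta>" by metis
next
  assume a: "And \<psi> \<chi> \<in> instances \<Gamma> \<Delta>"
  have "\<exists>\<theta> \<in> subformulas \<xi>. free_vars \<theta> \<subseteq> free_vars \<xi> \<and> \<psi> = inst s \<theta>"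
    "\<exists>\<theta> \<in> subformulas \<xi>. free_vars \<theta> \<subseteq> free_vars \<xi> \<and> \<chi> = inst s \<theta>"
    if "And \<psi> \<chi> = inst s \<xi>" for s \<xi>
    using that by (cases \<xi>; auto intro: subformulas_refl)+
  with a instances_part show "\<psi> \<in> instances \<Gamma> \<Delta> \<and> \<chi> \<in> instances \<Gamma> \<Delta>" by metis
next
  assume a: "Or \<psi> \<chi> \<in> instances \<Gamma> \<Delta>"
  have "\<exists>\<theta> \<in> subformulas \<xi>. free_vars \<theta> \<subseteq> free_vars \<xi> \<and> \<psi> = inst s \<theta>"
    "\<exists>\<theta> \<in> subformulas \<xi>. free_vars \<theta> \<subseteq> free_vars \<xi> \<and> \<chi> = inst s \<theta>"
    if "Or \<psi> \<chi> = inst s \<xi>" for s \<xi>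
    using that by (cases \<xi>; auto intro: subformulas_refl)+
  with a instances_part show "\<psi> \<in> instances \<Gamma> \<Delta> \<and> \<chi> \<in> instances \<Gamma> \<Delta>" by metis
qed

text \<open>Under the binder \<open>inst\<close> discards the value of \<open>s\<close> at
  \<open>x\<close>. Filling the gap with \<alpha> gives an instance under
  \<open>s(x \<mapsto> \<alpha>)\<close> of the body of the original quantified subformula.\<close>

lemma instances_quantifier:
  assumes "All x \<psi> \<in> instances \<Gamma> \<Delta> \<or> Ex x \<psi> \<in> instances \<Gamma> \<Delta>" "\<alpha> \<in> \<Delta>"
  shows "inst [x \<mapsto> \<alpha>] \<psi> \<in> instances \<Gamma> \<Delta>"
proof -
  obtain s \<chi> \<gamma> where *: "All x \<psi> = inst s \<chi> \<or> Ex x \<psi> = inst s \<chi>" "\<gamma> \<in> \<Gamma>" "\<chi> \<in> subformulas \<gamma>"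
    "free_vars \<chi> \<subseteq> dom s" "ran s \<subseteq> \<Delta>"
    using assms(1) by (metis instancesE)
  from *(1) obtain \<theta> where \<theta>: "\<chi> = All x \<theta> \<or> \<chi> = Ex x \<theta>" "\<psi> = inst (s(x := None)) \<theta>"
    by (cases \<chi>) auto
  have "[x \<mapsto> \<alpha>] ++ s(x := None) = s(x \<mapsto> \<alpha>)"
    by (auto simp: map_add_def split: option.splits)
  then have "inst [x \<mapsto> \<alpha>] \<psi> = inst (s(x \<mapsto> \<alpha>)) \<theta>"
    by (simp add: \<theta>(2) inst_inst)
  moreover have "\<theta> \<in> subformulas \<gamma>"
    using \<theta>(1) *(3) subformulas_refl[of \<theta>] subformulas_trans[of \<theta> \<chi> \<gamma>] by auto
  moreover have "free_vars \<theta> \<subseteq> dom (s(x \<mapsto> \<alpha>))"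
    using \<theta>(1) *(4) by auto
  moreover have "ran (s(x \<mapsto> \<alpha>)) \<subseteq> \<Delta>"
    using *(5) assms(2) by (auto simp: ran_def)
  ultimately show ?thesis using instancesI[OF *(2)] by metis
qed

section \<open>Forcing and truth in a position\<close>

lemma tm_value_inst:
  "tm_value M e (inst_tm s t) = tm_value M (e ++ (map_option (cinterp M) \<circ> s)) t"
  by (cases t) (auto simp: map_add_def split: option.splits)

lemma forces_inst:
  "forces M w e (inst s \<psi>) \<longleftrightarrow> forces M w (e ++ (map_option (cinterp M) \<circ> s)) \<psi>"
proof (induction \<psi> arbitrary: w e s)
  case (Atom p ts)
  show ?case by (simp add: tm_value_inst comp_def)
next
  case (All x \<psi>)
  have "e(x \<mapsto> d) ++ (map_option (cinterp M) \<circ> s(x := None)) =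
      (e ++ (map_option (cinterp M) \<circ> s))(x \<mapsto> d)" for d
    by (rule ext) (simp add: map_add_def split: option.split)
  with All show ?case by (simp del: fun_upd_apply o_apply)
next
  case (Ex x \<psi>)
  have "e(x \<mapsto> d) ++ (map_option (cinterp M) \<circ> s(x := None)) =
      (e ++ (map_option (cinterp M) \<circ> s))(x \<mapsto> d)" for d
    by (rule ext) (simp add: map_add_def split: option.split)
  with Ex show ?case by (simp del: fun_upd_apply o_apply)
qed simp_all

lemma forces_inst_single:
  "forces M w Map.empty (inst [x \<mapsto> \<alpha>] \<psi>) \<longleftrightarrow> forces M w [x \<mapsto> cinterp M \<alpha>] \<psi>"
proof -
  have "Map.empty ++ (map_option (cinterp M) \<circ> [x \<mapsto> \<alpha>]) = [x \<mapsto> cinterp M \<alpha>]"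
    by (auto simp: map_add_def)
  then show ?thesis by (simp add: forces_inst)
qed

section \<open>Frame axioms and persistence of forcing\<close>

lemma kripke_frameI:
  assumes "\<And>w. w \<in> worlds F \<Longrightarrow> (w, w) \<in> worldord F"
    and "\<And>u v w. (u, v) \<in> worldord F \<Longrightarrow> (v, w) \<in> worldord F \<Longrightarrow> (u, w) \<in> worldord F"
    and "\<And>u v. (u, v) \<in> worldord F \<Longrightarrow> (v, u) \<in> worldord F \<Longrightarrow> u = v"
    and "\<And>u v. (u, v) \<in> worldord F \<Longrightarrow> u \<in> worlds F \<and> v \<in> worlds F"
    and "\<And>u v. (u, v) \<in> worldord F \<Longrightarrow> domain F u \<subseteq> domain F v"
  shows "kripke_frame F"
proof -
  have "refl_on (worlds F) (worldord F)" using assms(1) by (rule refl_onI)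
  moreover have "trans (worldord F)" using assms(2) by (rule transI)
  moreover have "antisym (worldord F)" using assms(3) by (rule antisymI)
  moreover have "worldord F \<subseteq> worlds F \<times> worlds F" using assms(4) by auto
  moreover have "\<forall>(w, v) \<in> worldord F. domain F w \<subseteq> domain F v" using assms(5) by blast
  ultimately show ?thesis
    by (simp add: kripke_frame_def partial_order_on_def preorder_on_def)
qed

lemma kripke_frameD:
  assumes "kripke_frame F"
  shows "w \<in> worlds F \<Longrightarrow> (w, w) \<in> worldord F"
    and "(u, v) \<in> worldord F \<Longrightarrow> (v, w) \<in> worldord F \<Longrightarrow> (u, w) \<in> worldord F"
    and "(u, v) \<in> worldord F \<Longrightarrow> (v, u) \<in> worldord F \<Longrightarrow> u = v"
    and "(u, v) \<in> worldord F \<Longrightarrow> u \<in> worlds F \<and> v \<in> worlds F"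
    and "(u, v) \<in> worldord F \<Longrightarrow> domain F u \<subseteq> domain F v"
proof -
  have po: "partial_order_on (worlds F) (worldord F)" using assms by (simp add: kripke_frame_def)
  show "w \<in> worlds F \<Longrightarrow> (w, w) \<in> worldord F"
    using partial_order_onD(1)[OF po] by (rule refl_onD)
  show "(u, v) \<in> worldord F \<Longrightarrow> (v, w) \<in> worldord F \<Longrightarrow> (u, w) \<in> worldord F"
    using partial_order_onD(2)[OF po] by (rule transD)
  show "(u, v) \<in> worldord F \<Longrightarrow> (v, u) \<in> worldord F \<Longrightarrow> u = v"
    using partial_order_onD(3)[OF po] by (rule antisymD)
  show "(u, v) \<in> worldord F \<Longrightarrow> u \<in> worlds F \<and> v \<in> worlds F"
    using partial_order_onD(4)[OF po] by blast
  show "(u, v) \<in> worldord F \<Longrightarrow> domain F u \<subseteq> domain F v"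
    using assms unfolding kripke_frame_def by blast
qed

text \<open>Atoms are monotone only for tuples of individuals that exist at the earlier world; hence
  the values of the free variables and constants are required to lie in
  \<open>domain (frame_of M) w\<close>. Implication and universal quantification need only
  transitivity of the order.\<close>

lemma forces_persistent:
  assumes M: "kripke_model {} M" and wv: "(w, v) \<in> worldord (frame_of M)"
    and "forces M w e \<psi>" "free_vars \<psi> \<subseteq> dom e" "ran e \<subseteq> domain (frame_of M) w"
    and "cinterp M ` constants \<psi> \<subseteq> domain (frame_of M) w"
  shows "forces M v e \<psi>"
proof -
  have F: "kripke_frame (frame_of M)" using M by (simp add: kripke_model_def)
  note trans = kripke_frameD(2)[OF F wv]
  show ?thesis
    using assms(3-)
  proof (induction \<psi> arbitrary: e)
    case (Atom p ts)
    have "tm_value M e t \<in> domain (frame_of M) w" if t: "t \<in> set ts" for t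
    proof (cases t)
      case (Var x)
      with t Atom.prems(2) have "x \<in> dom e" by force
      with Var Atom.prems(3) show ?thesis by (auto simp: ran_def)
    next
      case (Con c)
      with t have "c \<in> constants (Atom p ts)" by force
      with Con Atom.prems(4) show ?thesis by auto
    qed
    then have "set (map (tm_value M e) ts) \<subseteq> domain (frame_of M) w" by auto
    then show ?case using Atom.prems(1) M wv by (fastforce simp: kripke_model_def)
  next
    case (Ex x \<psi>)
    then obtain d where d: "d \<in> domain (frame_of M) w" "forces M w (e(x \<mapsto> d)) \<psi>" by auto
    have "forces M v (e(x \<mapsto> d)) \<psi>"
    proof (rule Ex.IH[OF d(2)])
      show "ran (e(x \<mapsto> d)) \<subseteq> domain (frame_of M) w"
        using d(1) Ex.prems(3) by (auto simp: ran_def)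
    qed (use Ex.prems in auto)
    moreover have "d \<in> domain (frame_of M) v" using d(1) kripke_frameD(5)[OF F wv] by blast
    ultimately show ?case unfolding forces.simps by blast
  next
    case (Imp \<psi> \<chi>)
    show ?case unfolding forces.simps
    proof (intro allI impI)
      fix u assume "(v, u) \<in> worldord (frame_of M)" "forces M u e \<psi>"
      with Imp.prems(1) trans show "forces M u e \<chi>" by simp
    qed
  next
    case (All x \<psi>)
    show ?case unfolding forces.simps
    proof (intro allI impI ballI)
      fix u d assume "(v, u) \<in> worldord (frame_of M)" "d \<in> domain (frame_of M) u"
      with All.prems(1) trans show "forces M u (e(x \<mapsto> d)) \<psi>" by simp
    qed
  next
    case (And \<psi> \<chi>)
    then show ?case by (simp add: image_Un)
  next
    case (Or \<psi> \<chi>)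
    from Or.prems(2-4) have "forces M w e \<psi> \<Longrightarrow> forces M v e \<psi>" "forces M w e \<chi> \<Longrightarrow> forces M v e \<chi>"
      by (simp_all add: image_Un Or.IH)
    with Or.prems(1) show ?case by auto
  qed simp
qed

text \<open>The common core of both directions: a world and a position agree as soon as the formulas
  claimed by either player cannot fail later on, so that only the local, classical part of the
  forcing clauses for implication and universal quantification matters.\<close>

lemma holds_iff_forces:
  assumes F: "kripke_frame (frame_of M)" and w: "w \<in> worlds (frame_of M)"
    and dom: "domain (frame_of M) w = cinterp M ` objs C"
    and atoms: "\<And>p ts. Atom p ts \<in> instances \<Gamma> (objs C) \<Longrightarrow>
      Atom p ts \<in> opp C \<longleftrightarrow> forces M w Map.empty (Atom p ts)"
    and claimed: "\<And>\<psi>. \<psi> \<in> instances \<Gamma> (objs C) \<Longrightarrow> forces M w Map.empty \<psi> \<Longrightarrow> \<psi> \<in> opp C \<union> pro C"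
    and later: "\<And>\<psi> v. \<psi> \<in> instances \<Gamma> (objs C) \<Longrightarrow> \<psi> \<in> opp C \<union> pro C \<Longrightarrow>
      (w, v) \<in> worldord (frame_of M) \<Longrightarrow> v \<noteq> w \<Longrightarrow> forces M v Map.empty \<psi>"
    and \<psi>: "\<psi> \<in> instances \<Gamma> (objs C)"
  shows "holds C \<psi> \<longleftrightarrow> forces M w Map.empty \<psi>"
proof -
  note refl = kripke_frameD(1)[OF F w]
  show ?thesis
    using \<psi>
  proof (induction "height \<psi>" arbitrary: \<psi> rule: less_induct)
    case less
    show ?case
    proof (cases \<psi>)
      case (Atom p ts)
      then show ?thesis using atoms less.prems by simp
    next
      case (Imp \<theta> \<chi>)
      note prem = less.prems[unfolded Imp]
      note parts = instances_binary(1)[OF prem]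
      have IH: "holds C \<theta> \<longleftrightarrow> forces M w Map.empty \<theta>" "holds C \<chi> \<longleftrightarrow> forces M w Map.empty \<chi>"
        using less.hyps Imp parts by auto
      show ?thesis unfolding Imp
      proof
        assume "holds C (Imp \<theta> \<chi>)"
        then have h: "Imp \<theta> \<chi> \<in> opp C \<union> pro C" "holds C \<theta> \<longrightarrow> holds C \<chi>" by auto
        have "forces M v Map.empty \<chi>"
          if v: "(w, v) \<in> worldord (frame_of M)" "forces M v Map.empty \<theta>" for v
        proof (cases "v = w")
          case True
          with v h IH show ?thesis by simp
        next
          case False
          \<comment> \<open>Strictly above \<open>w\<close> the claimed implication is forced as a
            whole, and reflexivity lets it be applied at \<open>v\<close> itself.\<close>
          from later[OF prem h(1) v(1) False] v(2) kripke_frameD(1,4)[OF F] v(1)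
          show ?thesis by auto
        qed
        then show "forces M w Map.empty (Imp \<theta> \<chi>)" by simp
      next
        assume f: "forces M w Map.empty (Imp \<theta> \<chi>)"
        from claimed[OF prem f] f refl IH show "holds C (Imp \<theta> \<chi>)" by simp
      qed
    next
      case (And \<theta> \<chi>)
      note prem = less.prems[unfolded And]
      have IH: "holds C \<theta> \<longleftrightarrow> forces M w Map.empty \<theta>" "holds C \<chi> \<longleftrightarrow> forces M w Map.empty \<chi>"
        using less.hyps And instances_binary(2)[OF prem] by auto
      with claimed[OF prem] show ?thesis unfolding And by auto
    next
      case (Or \<theta> \<chi>)
      note prem = less.prems[unfolded Or]
      have IH: "holds C \<theta> \<longleftrightarrow> forces M w Map.empty \<theta>" "holds C \<chi> \<longleftrightarrow> forces M w Map.empty \<chi>"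
        using less.hyps Or instances_binary(3)[OF prem] by auto
      with claimed[OF prem] show ?thesis unfolding Or by auto
    next
      case (All x \<theta>)
      note prem = less.prems[unfolded All]
      have IH: "holds C (inst [x \<mapsto> \<alpha>] \<theta>) \<longleftrightarrow> forces M w [x \<mapsto> cinterp M \<alpha>] \<theta>" if "\<alpha> \<in> objs C" for \<alpha>
        using less.hyps All instances_quantifier[OF disjI1[OF prem] that] that by (simp add: forces_inst_single)
      show ?thesis unfolding All
      proof
        assume "holds C (All x \<theta>)"
        then have h: "All x \<theta> \<in> opp C \<union> pro C" "\<forall>\<alpha> \<in> objs C. holds C (inst [x \<mapsto> \<alpha>] \<theta>)"
          by auto
        have "forces M v [x \<mapsto> d] \<theta>"
          if v: "(w, v) \<in> worldord (frame_of M)" "d \<in> domain (frame_of M) v" for v d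
        proof (cases "v = w")
          case True
          \<comment> \<open>At \<open>w\<close> every individual is named by some object, so
            quantifying over individuals amounts to quantifying over objects.\<close>
          with v dom obtain \<alpha> where "\<alpha> \<in> objs C" "d = cinterp M \<alpha>" by auto
          with h IH True show ?thesis by simp
        next
          case False
          from later[OF prem h(1) v(1) False] v(2) kripke_frameD(1,4)[OF F] v(1)
          show ?thesis by auto
        qed
        then show "forces M w Map.empty (All x \<theta>)" by simp
      next
        assume f: "forces M w Map.empty (All x \<theta>)"
        from claimed[OF prem f] f refl IH dom show "holds C (All x \<theta>)" by simp
      qed
    next
      case (Ex x \<theta>)
      note prem = less.prems[unfolded Ex]
      have IH: "holds C (inst [x \<mapsto> \<alpha>] \<theta>) \<longleftrightarrow> forces M w [x \<mapsto> cinterp M \<alpha>] \<theta>" if "\<alpha> \<in> objs C" for \<alpha>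
        using less.hyps Ex instances_quantifier[OF disjI2[OF prem] that] that by (simp add: forces_inst_single)
      have "forces M w Map.empty (Ex x \<theta>) \<longleftrightarrow> (\<exists>\<alpha> \<in> objs C. holds C (inst [x \<mapsto> \<alpha>] \<theta>))"
        using IH dom by auto
      with claimed[OF prem] show ?thesis unfolding Ex by auto
    qed simp
  qed
qed

section \<open>Refuting strategies by Noetherian countermodels\<close>

text \<open>A \<open>play\<close> may have been ended by its last move. This is excluded here, so
  that the play can be prolonged.\<close>

definition ongoing ::
  "('p, 'a) fm set \<Rightarrow> ('p, 'a) position \<Rightarrow> (('p, 'a) position list \<Rightarrow> ('p, 'a) position) \<Rightarrow>
    ('p, 'a) position list \<Rightarrow> bool" where
  "ongoing \<Gamma> C \<sigma> h \<longleftrightarrow> play \<Gamma> C h \<and> follows Proponent \<sigma> h \<and> (\<forall>i. \<not> over_after h i)"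

lemma ongoing_start: "ongoing \<Gamma> C \<sigma> [C]"
  by (simp add: ongoing_def play_def follows_def over_after_def)

lemma over_after_snoc:
  "over_after (h @ [X]) i \<longleftrightarrow>
    over_after h i \<or> h \<noteq> [] \<and> Suc i = length h \<and> to_move (last h) = to_move X"
proof (cases "Suc i = length h")
  case True
  then have "h \<noteq> []" by auto
  moreover have "last h = h ! i" using True \<open>h \<noteq> []\<close> by (metis diff_Suc_1 last_conv_nth)
  ultimately show ?thesis using True by (simp add: over_after_def nth_append flip: True)
next
  case False
  then show ?thesis by (auto simp: over_after_def nth_append)
qed

lemma play_snoc:
  assumes "ongoing \<Gamma> C \<sigma> h" "legal_move \<Gamma> (last h) X" "to_move (last h) = Proponent \<Longrightarrow> X = \<sigma> h"
  shows "play \<Gamma> C (h @ [X]) \<and> follows Proponent \<sigma> (h @ [X])"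
proof -
  have h: "h \<noteq> []" and p: "play \<Gamma> C h" and f: "follows Proponent \<sigma> h" and o: "\<And>i. \<not> over_after h i"
    using assms(1) by (auto simp: ongoing_def play_def)
  have snoc: "(h @ [X]) ! Suc i = X \<and> (h @ [X]) ! i = last h \<and> take (Suc i) (h @ [X]) = h"
    if "Suc i = length h" for i
    using that h by (simp add: nth_append last_conv_nth flip: that)
  have old: "(h @ [X]) ! Suc i = h ! Suc i \<and> (h @ [X]) ! i = h ! i \<and>
      take (Suc i) (h @ [X]) = take (Suc i) h"
    if "Suc i < length h" for i
    using that by (simp add: nth_append)
  have split: "Suc i < length h \<or> Suc i = length h" if "Suc i < length (h @ [X])" for i
    using that by auto
  have "legal_move \<Gamma> ((h @ [X]) ! i) ((h @ [X]) ! Suc i)" if "Suc i < length (h @ [X])" for i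
    using split[OF that] snoc[of i] old[of i] assms(2) p by (auto simp: play_def)
  moreover have "\<not> over_after (h @ [X]) i" if "Suc (Suc i) < length (h @ [X])" for i
    using that o by (auto simp: over_after_snoc)
  moreover have "(h @ [X]) ! Suc i = \<sigma> (take (Suc i) (h @ [X]))"
    if "Suc i < length (h @ [X])" "to_move ((h @ [X]) ! i) = Proponent" for i
    using split[OF that(1)] that(2) snoc[of i] old[of i] assms(3) f by (auto simp: follows_def)
  ultimately show ?thesis using h p by (simp add: play_def follows_def)
qed

lemma ongoing_snoc:
  assumes "ongoing \<Gamma> C \<sigma> h" "legal_move \<Gamma> (last h) X" "to_move (last h) = Proponent \<Longrightarrow> X = \<sigma> h"
    and "to_move (last h) \<noteq> to_move X"
  shows "ongoing \<Gamma> C \<sigma> (h @ [X])"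
  using play_snoc[OF assms(1-3)] assms(1,4) by (simp add: ongoing_def over_after_snoc)

text \<open>If Proponent still had to move after the prescribed move, the prolonged play would be a
  finite play that follows \<open>\<sigma>\<close> and is lost by Proponent.\<close>

lemma winning_strategy_move:
  assumes win: "proponent_winning_strategy \<Gamma> C \<sigma>" and h: "ongoing \<Gamma> C \<sigma> h"
    and P: "to_move (last h) = Proponent"
  shows "player_move \<Gamma> Proponent (last h) (\<sigma> h)" "to_move (\<sigma> h) = Opponent"
    "ongoing \<Gamma> C \<sigma> (h @ [\<sigma> h])"
proof -
  have ne: "h \<noteq> []" using h by (auto simp: ongoing_def play_def)
  have "\<not> lost_by Opponent h" using h by (simp add: ongoing_def lost_by_def)
  then have legal: "legal_move \<Gamma> (last h) (\<sigma> h)"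
    using win h P unfolding proponent_winning_strategy_def ongoing_def by blast
  then show "player_move \<Gamma> Proponent (last h) (\<sigma> h)" using P by (simp add: legal_move_def)
  have "\<not> lost_by Proponent (h @ [\<sigma> h])"
    using win play_snoc[OF h legal] unfolding proponent_winning_strategy_def by blast
  moreover have "lost_by Proponent (h @ [\<sigma> h])" if "to_move (\<sigma> h) = Proponent"
    unfolding lost_by_def
  proof (intro exI conjI)
    show "over_after (h @ [\<sigma> h]) (length h - 1)"
      using ne P that by (simp add: over_after_snoc)
    show "to_move ((h @ [\<sigma> h]) ! (length h - 1)) = Proponent"
      using ne P by (simp add: nth_append last_conv_nth)
  qed
  ultimately show "to_move (\<sigma> h) = Opponent" by (cases "to_move (\<sigma> h)") auto
  then show "ongoing \<Gamma> C \<sigma> (h @ [\<sigma> h])" using ongoing_snoc[OF h legal] P by simp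
qed

text \<open>The relation is the reversed strict order, so an induction hypothesis speaks about
  strictly larger worlds.\<close>

lemma noetherian_wf:
  assumes "F \<in> noetherian_frames"
  shows "wf {(v, w). (w, v) \<in> worldord F \<and> w \<noteq> v}"
  using assms unfolding noetherian_frames_def wf_iff_no_infinite_down_chain by auto

text \<open>A Noetherian model seen from the game: \<open>A w\<close> is the set of names of the individuals that
  exist at the world \<open>w\<close>; one individual may have several names.\<close>

locale object_model =
  fixes N :: "('p, 'a, 'w, 'd) kmodel" and \<Gamma> :: "('p, 'a) fm set" and A :: "'w \<Rightarrow> 'a set"
  assumes model: "kripke_model {} N" and noetherian: "frame_of N \<in> noetherian_frames"
    and names: "\<And>w. w \<in> worlds (frame_of N) \<Longrightarrow> cinterp N ` A w = domain (frame_of N) w"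
    and names_mono: "\<And>w v. (w, v) \<in> worldord (frame_of N) \<Longrightarrow> A w \<subseteq> A v"
    and constants_named: "\<And>w \<gamma>. w \<in> worlds (frame_of N) \<Longrightarrow> \<gamma> \<in> \<Gamma> \<Longrightarrow> constants \<gamma> \<subseteq> A w"
begin

lemma frame: "kripke_frame (frame_of N)"
  using model by (simp add: kripke_model_def)

lemma forces_instance_persistent:
  assumes \<psi>: "\<psi> \<in> instances \<Gamma> (A w)" and f: "forces N w Map.empty \<psi>"
    and wv: "(w, v) \<in> worldord (frame_of N)"
  shows "forces N v Map.empty \<psi>"
proof (rule forces_persistent[OF model wv f])
  have w: "w \<in> worlds (frame_of N)" using kripke_frameD(4)[OF frame wv] by simp
  have "constants \<psi> \<subseteq> A w"
    using constants_instances[OF \<psi>] constants_named[OF w] by blast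
  then show "cinterp N ` constants \<psi> \<subseteq> domain (frame_of N) w"
    using names[OF w] by blast
qed (simp_all add: closed_instances[OF \<psi>])

definition world_position :: "'w \<Rightarrow> ('p, 'a) fm set \<Rightarrow> ('p, 'a) position" where
  "world_position w P = \<lparr>opp = {\<psi> \<in> instances \<Gamma> (A w). forces N w Map.empty \<psi>}, pro = P, objs = A w\<rparr>"

definition refutes :: "'w \<Rightarrow> ('p, 'a) fm set \<Rightarrow> bool" where
  "refutes w P \<longleftrightarrow> w \<in> worlds (frame_of N) \<and> (\<exists>\<psi> \<in> P. \<not> forces N w Map.empty \<psi>)"

definition critical :: "'w \<Rightarrow> ('p, 'a) fm set \<Rightarrow> bool" where
  "critical w P \<longleftrightarrow> refutes w P \<and> (\<forall>v. (w, v) \<in> worldord (frame_of N) \<longrightarrow> v \<noteq> w \<longrightarrow> \<not> refutes v P)"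

lemma critical_above:
  assumes "refutes w P"
  obtains v where "(w, v) \<in> worldord (frame_of N)" "critical v P"
proof -
  have "\<exists>v. (w, v) \<in> worldord (frame_of N) \<and> critical v P"
    using assms
  proof (induction w rule: wf_induct_rule[OF noetherian_wf[OF noetherian]])
    case (1 w)
    show ?case
    proof (cases "critical w P")
      case True
      then show ?thesis using 1(2) kripke_frameD(1)[OF frame] by (auto simp: refutes_def)
    next
      case False
      with 1(2) obtain u where u: "(w, u) \<in> worldord (frame_of N)" "u \<noteq> w" "refutes u P"
        by (auto simp: critical_def)
      with 1(1)[of u] obtain v where "(u, v) \<in> worldord (frame_of N)" "critical v P" by auto
      with u kripke_frameD(2)[OF frame] show ?thesis by blast
    qed
  qed
  with that show thesis by blast
qed

text \<open>Since truth agrees with forcing here, all of Opponent's claims are true, while the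
  formula of \<open>P\<close> refuted at \<open>w\<close> is a mistake of Proponent.\<close>

lemma proponent_moves_at_critical:
  assumes crit: "critical w P" and P: "P \<subseteq> instances \<Gamma> (A w)"
  shows "to_move (world_position w P) = Proponent"
proof -
  have w: "w \<in> worlds (frame_of N)" using crit by (simp add: critical_def refutes_def)
  have holds: "holds (world_position w P) \<psi> \<longleftrightarrow> forces N w Map.empty \<psi>"
    if "\<psi> \<in> instances \<Gamma> (A w)" for \<psi>
  proof (rule holds_iff_forces[OF frame w, of _ \<Gamma>])
    fix \<psi> v
    assume *: "\<psi> \<in> instances \<Gamma> (objs (world_position w P))"
      "\<psi> \<in> opp (world_position w P) \<union> pro (world_position w P)"
      "(w, v) \<in> worldord (frame_of N)" "v \<noteq> w"
    have v: "v \<in> worlds (frame_of N)" using kripke_frameD(4)[OF frame *(3)] by simp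
    from *(2) show "forces N v Map.empty \<psi>"
    proof
      assume "\<psi> \<in> opp (world_position w P)"
      then show ?thesis
        using forces_instance_persistent[OF _ _ *(3)] by (simp add: world_position_def)
    next
      assume "\<psi> \<in> pro (world_position w P)"
      then show ?thesis
        using crit *(3,4) v by (auto simp: critical_def refutes_def world_position_def)
    qed
  qed (use that names[OF w] in \<open>auto simp: world_position_def simp del: forces.simps\<close>)
  have "mistakes Opponent (world_position w P) = {}"
    using holds by (auto simp: world_position_def)
  moreover obtain \<psi> where "\<psi> \<in> P" "\<not> forces N w Map.empty \<psi>"
    using crit by (auto simp: critical_def refutes_def)
  then have "\<psi> \<in> mistakes Proponent (world_position w P)"
    using holds P by (auto simp: world_position_def)
  ultimately show ?thesis unfolding to_move_def by auto
qed

text \<open>Stated for any position that fits into \<open>w\<close>, since it provides both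
  Opponent's first move, made before any world has been represented, and all later replies.\<close>

lemma opponent_reply:
  assumes h: "ongoing \<Gamma> C \<sigma> h" and O: "to_move (last h) = Opponent"
    and objs: "objs (last h) \<subseteq> A w"
    and opp: "opp (last h) \<subseteq> {\<psi> \<in> instances \<Gamma> (A w). forces N w Map.empty \<psi>}"
    and pro: "pro (last h) \<subseteq> instances \<Gamma> (objs (last h))"
    and ref: "refutes w (pro (last h))"
  obtains v where "(w, v) \<in> worldord (frame_of N)" "critical v (pro (last h))"
    "pro (last h) \<subseteq> instances \<Gamma> (A v)" "ongoing \<Gamma> C \<sigma> (h @ [world_position v (pro (last h))])"
proof -
  obtain v where v: "(w, v) \<in> worldord (frame_of N)" "critical v (pro (last h))"
    using critical_above[OF ref] by blast
  have Av: "A w \<subseteq> A v" by (rule names_mono[OF v(1)])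
  have P: "pro (last h) \<subseteq> instances \<Gamma> (A v)"
    using pro instances_mono[of "objs (last h)" "A v" \<Gamma>] objs Av by blast
  have "opp (last h) \<subseteq> opp (world_position v (pro (last h)))"
    using opp forces_instance_persistent[OF _ _ v(1)] instances_mono[OF Av, of \<Gamma>]
    by (auto simp: world_position_def)
  then have "legal_move \<Gamma> (last h) (world_position v (pro (last h)))"
    using O objs Av by (auto simp: legal_move_def world_position_def)
  then have "ongoing \<Gamma> C \<sigma> (h @ [world_position v (pro (last h))])"
    by (rule ongoing_snoc[OF h]) (simp_all add: O proponent_moves_at_critical[OF v(2) P])
  with that v P show thesis by blast
qed

text \<open>Proponent can only add formulas to \<open>P\<close>, so \<open>w\<close> still refutes
  the larger set and Opponent finds a critical world for it at or above \<open>w\<close>.\<close>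

lemma critical_not_winning:
  assumes win: "proponent_winning_strategy \<Gamma> C \<sigma>"
    and "ongoing \<Gamma> C \<sigma> h" "last h = world_position w P" "critical w P" "P \<subseteq> instances \<Gamma> (A w)"
  shows False
  using assms(2-)
proof (induction w arbitrary: h P rule: wf_induct_rule[OF noetherian_wf[OF noetherian]])
  case (1 w)
  let ?D = "\<sigma> h"
  have P: "to_move (last h) = Proponent"
    using proponent_moves_at_critical 1(3-5) by simp
  note move = winning_strategy_move[OF win 1(2) P]
  have D: "?D = world_position w (pro ?D)" "P \<subseteq> pro ?D" "pro ?D \<subseteq> instances \<Gamma> (A w)"
    using move(1) 1(3,5) by (auto simp: world_position_def)
  have D': "opp ?D = {\<psi> \<in> instances \<Gamma> (A w). forces N w Map.empty \<psi>}" "objs ?D = A w"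
    using move(1) 1(3) by (auto simp: world_position_def)
  have "refutes w (pro ?D)" using 1(4) D(2) by (auto simp: critical_def refutes_def)
  then obtain v where v: "(w, v) \<in> worldord (frame_of N)" "critical v (pro ?D)"
    "pro ?D \<subseteq> instances \<Gamma> (A v)" "ongoing \<Gamma> C \<sigma> ((h @ [?D]) @ [world_position v (pro ?D)])"
    using opponent_reply[OF move(3), of w] move(2) D D' by auto
  \<comment> \<open>For \<open>v = w\<close> the reply would be the very position reached by the
    strategy, where Opponent is to move; at a critical world it is Proponent's turn.\<close>
  have "v \<noteq> w"
    using proponent_moves_at_critical[OF v(2,3)] D(1) move(2) by (metis player.distinct(1))
  then show False using 1(1)[OF _ v(4) _ v(2,3)] v(1) by simp
qed

lemma refuted_not_winning:
  assumes objs: "objs C \<subseteq> A w"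
    and opp: "opp C \<subseteq> {\<psi> \<in> instances \<Gamma> (A w). forces N w Map.empty \<psi>}"
    and pro: "pro C \<subseteq> instances \<Gamma> (objs C)" and ref: "refutes w (pro C)"
  shows "\<not> proponent_winning_strategy \<Gamma> C \<sigma>"
proof
  assume win: "proponent_winning_strategy \<Gamma> C \<sigma>"
  \<comment> \<open>Proponent may have to move already at the start. The prescribed move is then
    played first, so that in both cases it is Opponent's turn.\<close>
  obtain h where h: "ongoing \<Gamma> C \<sigma> h" "to_move (last h) = Opponent" "objs (last h) = objs C"
    "opp (last h) = opp C" "pro C \<subseteq> pro (last h)" "pro (last h) \<subseteq> instances \<Gamma> (objs C)"
  proof (cases "to_move C")
    case Opponent
    with that[OF ongoing_start] pro show thesis by simp
  next
    case Proponent
    then have "to_move (last [C]) = Proponent" by simp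
    note move = winning_strategy_move[OF win ongoing_start this]
    show thesis by (rule that[OF move(3)]) (use move(1,2) pro in auto)
  qed
  have "refutes w (pro (last h))" using ref h(5) by (auto simp: refutes_def)
  then obtain v where "critical v (pro (last h))" "pro (last h) \<subseteq> instances \<Gamma> (A v)"
    "ongoing \<Gamma> C \<sigma> (h @ [world_position v (pro (last h))])"
    using opponent_reply[OF h(1,2), of w] h(3-6) objs opp by metis
  then show False using critical_not_winning[OF win] by (metis last_snoc)
qed

end

section \<open>Cardinality of the set of formulas\<close>

lemma lepoll_UNIV_iff_inj: "(UNIV :: 'a set) \<lesssim> (UNIV :: 'b set) \<longleftrightarrow> (\<exists>f :: 'a \<Rightarrow> 'b. inj f)"
  by (simp add: lepoll_def)

text \<open>An infinite type is equinumerous with its square. The values of \<open>num\<close> later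
  serve as tags of constructors and as codes of variables.\<close>

lemma infinite_pairing:
  assumes "infinite (UNIV :: 'd set)"
  obtains pr :: "'d \<Rightarrow> 'd \<Rightarrow> 'd" and num :: "nat \<Rightarrow> 'd"
  where "\<And>a b c d. pr a b = pr c d \<longleftrightarrow> a = c \<and> b = d" "\<And>m n. num m = num n \<longleftrightarrow> m = n"
proof -
  obtain q :: "'d \<times> 'd \<Rightarrow> 'd" where "bij_betw q (UNIV \<times> UNIV) UNIV"
    using card_of_Times_same_infinite[OF assms] unfolding card_of_ordIso[symmetric] by blast
  then have q: "inj q" by (simp add: bij_betw_def)
  obtain num :: "nat \<Rightarrow> 'd" where "inj num"
    using assms by (auto simp: infinite_le_lepoll lepoll_def)
  with q that[of "\<lambda>a b. q (a, b)" num] show thesis by (simp add: inj_eq)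
qed

section \<open>Injective codes of terms and formulas\<close>

context
  fixes pr :: "'d \<Rightarrow> 'd \<Rightarrow> 'd" and num :: "nat \<Rightarrow> 'd" and cp :: "'p \<Rightarrow> 'd" and ca :: "'a \<Rightarrow> 'd"
begin

primrec list_code :: "'d list \<Rightarrow> 'd" where
  "list_code [] = pr (num 0) (num 0)"
| "list_code (x # xs) = pr (num 1) (pr x (list_code xs))"

primrec tm_code :: "'a tm \<Rightarrow> 'd" where
  "tm_code (Var x) = pr (num 0) (num x)"
| "tm_code (Con c) = pr (num 1) (ca c)"

primrec fm_code :: "('p, 'a) fm \<Rightarrow> 'd" where
  "fm_code Bot = pr (num 0) (num 0)"
| "fm_code (Atom p ts) = pr (num 1) (pr (cp p) (list_code (map tm_code ts)))"
| "fm_code (Imp \<psi> \<chi>) = pr (num 2) (pr (fm_code \<psi>) (fm_code \<chi>))"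
| "fm_code (And \<psi> \<chi>) = pr (num 3) (pr (fm_code \<psi>) (fm_code \<chi>))"
| "fm_code (Or \<psi> \<chi>) = pr (num 4) (pr (fm_code \<psi>) (fm_code \<chi>))"
| "fm_code (All x \<psi>) = pr (num 5) (pr (num x) (fm_code \<psi>))"
| "fm_code (Ex x \<psi>) = pr (num 6) (pr (num x) (fm_code \<psi>))"

lemma inj_fm_code:
  assumes pr: "\<And>a b c d. pr a b = pr c d \<longleftrightarrow> a = c \<and> b = d" and num: "\<And>m n. num m = num n \<longleftrightarrow> m = n"
    and "inj cp" "inj ca"
  shows "inj fm_code"
proof -
  have list: "list_code xs = list_code ys \<Longrightarrow> xs = ys" for xs ys
  proof (induction xs arbitrary: ys)
    case Nil
    then show ?case by (cases ys) (simp_all add: pr num)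
  next
    case (Cons x xs)
    then show ?case by (cases ys) (simp_all add: pr num)
  qed
  have tm: "tm_code t = tm_code u \<longleftrightarrow> t = u" for t u
    by (cases t; cases u) (simp_all add: pr num inj_eq[OF \<open>inj ca\<close>])
  have "inj tm_code" using tm by (simp add: inj_def)
  then have tms: "list_code (map tm_code ts) = list_code (map tm_code us) \<Longrightarrow> ts = us" for ts us
    using list by (metis inj_map_eq_map)
  have "fm_code \<psi> = fm_code \<chi> \<Longrightarrow> \<psi> = \<chi>" for \<psi> \<chi>
  proof (induction \<psi> arbitrary: \<chi>)
    case Bot
    then show ?case by (cases \<chi>) (simp_all add: pr num)
  next
    case (Atom p ts)
    then show ?case by (cases \<chi>) (auto simp: pr num inj_eq[OF \<open>inj cp\<close>] dest: tms)
  next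
    case (Imp \<psi>1 \<psi>2)
    then show ?case by (cases \<chi>) (simp_all add: pr num)
  next
    case (And \<psi>1 \<psi>2)
    then show ?case by (cases \<chi>) (simp_all add: pr num)
  next
    case (Or \<psi>1 \<psi>2)
    then show ?case by (cases \<chi>) (simp_all add: pr num)
  next
    case (All x \<psi>)
    then show ?case by (cases \<chi>) (simp_all add: pr num)
  next
    case (Ex x \<psi>)
    then show ?case by (cases \<chi>) (simp_all add: pr num)
  qed
  then show ?thesis by (simp add: inj_def)
qed

end

text \<open>Formulas index the countermodels to be glued, so their number bounds the number of
  components.\<close>

lemma fm_lepoll:
  assumes "infinite (UNIV :: 'd set)" "(UNIV :: 'p set) \<lesssim> (UNIV :: 'd set)"
    and "(UNIV :: 'a set) \<lesssim> (UNIV :: 'd set)"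
  shows "(UNIV :: ('p, 'a) fm set) \<lesssim> (UNIV :: 'd set)"
proof -
  obtain cp :: "'p \<Rightarrow> 'd" and ca :: "'a \<Rightarrow> 'd" where c: "inj cp" "inj ca"
    using assms(2,3) by (auto simp: lepoll_UNIV_iff_inj)
  obtain pr :: "'d \<Rightarrow> 'd \<Rightarrow> 'd" and num :: "nat \<Rightarrow> 'd" where
    pr: "\<And>a b c d. pr a b = pr c d \<longleftrightarrow> a = c \<and> b = d" and num: "\<And>m n. num m = num n \<longleftrightarrow> m = n"
    using infinite_pairing[OF assms(1)] by blast
  have "inj (fm_code pr num cp ca)" by (rule inj_fm_code[OF pr num c])
  then show ?thesis unfolding lepoll_UNIV_iff_inj by blast
qed

lemma sum_lepoll:
  assumes "infinite (UNIV :: 'd set)" "(UNIV :: 'a set) \<lesssim> (UNIV :: 'd set)"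
    and "(UNIV :: 'b set) \<lesssim> (UNIV :: 'd set)"
  shows "(UNIV :: ('a + 'b) set) \<lesssim> (UNIV :: 'd set)"
proof -
  obtain f :: "'a \<Rightarrow> 'd" and g :: "'b \<Rightarrow> 'd" where fg: "inj f" "inj g"
    using assms(2,3) by (auto simp: lepoll_UNIV_iff_inj)
  obtain pr :: "'d \<Rightarrow> 'd \<Rightarrow> 'd" and num :: "nat \<Rightarrow> 'd" where
    pr: "\<And>a b c d. pr a b = pr c d \<longleftrightarrow> a = c \<and> b = d" and num: "\<And>m n. num m = num n \<longleftrightarrow> m = n"
    using infinite_pairing[OF assms(1)] by blast
  have "inj (case_sum (\<lambda>x. pr (num 0) (f x)) (\<lambda>y. pr (num 1) (g y)))"
    using fg by (auto simp: inj_def pr num split: sum.splits)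
  then show ?thesis unfolding lepoll_UNIV_iff_inj by blast
qed

lemma obj_lepoll:
  assumes "infinite (UNIV :: 'd set)" "(UNIV :: 'c set) \<lesssim> (UNIV :: 'd set)"
  shows "(UNIV :: ('c, 'd) obj set) \<lesssim> (UNIV :: 'd set)"
proof -
  have "inj (case_obj Inl Inr :: ('c, 'd) obj \<Rightarrow> 'c + 'd)"
    by (auto simp: inj_def split: obj.splits)
  then have "(UNIV :: ('c, 'd) obj set) \<lesssim> (UNIV :: ('c + 'd) set)"
    unfolding lepoll_UNIV_iff_inj by blast
  also have "\<dots> \<lesssim> (UNIV :: 'd set)" by (rule sum_lepoll[OF assms lepoll_refl])
  finally show ?thesis .
qed

text \<open>The type of worlds of the glued model: a root, and pairs of an index and a world of the
  component with that index.\<close>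

lemma option_prod_lepoll:
  assumes "infinite (UNIV :: 'w set)" "(UNIV :: 'a set) \<lesssim> (UNIV :: 'w set)"
  shows "(UNIV :: ('a \<times> 'w) option set) \<lesssim> (UNIV :: 'w set)"
proof -
  obtain f :: "'a \<Rightarrow> 'w" where f: "inj f"
    using assms(2) by (auto simp: lepoll_UNIV_iff_inj)
  obtain pr :: "'w \<Rightarrow> 'w \<Rightarrow> 'w" and num :: "nat \<Rightarrow> 'w" where
    pr: "\<And>a b c d. pr a b = pr c d \<longleftrightarrow> a = c \<and> b = d" and num: "\<And>m n. num m = num n \<longleftrightarrow> m = n"
    using infinite_pairing[OF assms(1)] by blast
  have "inj (case_option (pr (num 0) (num 0)) (\<lambda>(x, w). pr (num 1) (pr (f x) w)))"
    using f by (auto simp: inj_def pr num split: option.splits)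
  then show ?thesis unfolding lepoll_UNIV_iff_inj by blast
qed

section \<open>Consequence and change of types\<close>

text \<open>A bounded morphism \<open>f\<close> from the up-closed part \<open>S\<close> of
  \<open>M\<close>, combined with a map \<open>g\<close> that sends each domain onto the
  corresponding one. Without equality in the language, \<open>g\<close> may identify individuals, as
  happens when a glued component is projected to the model it came from.\<close>

lemma forces_p_morphism:
  assumes up: "\<And>w v. w \<in> S \<Longrightarrow> (w, v) \<in> worldord (frame_of M) \<Longrightarrow> v \<in> S"
    and zig: "\<And>w v. w \<in> S \<Longrightarrow> (w, v) \<in> worldord (frame_of M) \<Longrightarrow> (f w, f v) \<in> worldord (frame_of N)"
    and zag: "\<And>w u. w \<in> S \<Longrightarrow> (f w, u) \<in> worldord (frame_of N) \<Longrightarrow>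
      \<exists>v. (w, v) \<in> worldord (frame_of M) \<and> u = f v"
    and dom: "\<And>w. w \<in> S \<Longrightarrow> domain (frame_of N) (f w) = g ` domain (frame_of M) w"
    and con: "\<And>c. cinterp N c = g (cinterp M c)"
    and pred: "\<And>w p ds. w \<in> S \<Longrightarrow> pinterp M w p ds \<longleftrightarrow> pinterp N (f w) p (map g ds)"
    and "w \<in> S" "free_vars \<psi> \<subseteq> Map.dom e"
  shows "forces M w e \<psi> \<longleftrightarrow> forces N (f w) (map_option g \<circ> e) \<psi>"
  using assms(7-)
proof (induction \<psi> arbitrary: w e)
  case (Atom p ts)
  have "g (tm_value M e t) = tm_value N (map_option g \<circ> e) t" if "t \<in> set ts" for t
  proof (cases t)
    case (Var x)
    with that Atom.prems(2) have "x \<in> Map.dom e" by force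
    with Var show ?thesis by auto
  next
    case (Con c)
    then show ?thesis by (simp add: con)
  qed
  then have "map g (map (tm_value M e) ts) = map (tm_value N (map_option g \<circ> e)) ts"
    by simp
  then show ?case using pred[OF Atom.prems(1)] by (simp del: map_map o_apply)
next
  case (Imp \<psi> \<chi>)
  have IH: "forces M v e \<psi> \<longleftrightarrow> forces N (f v) (map_option g \<circ> e) \<psi>"
    "forces M v e \<chi> \<longleftrightarrow> forces N (f v) (map_option g \<circ> e) \<chi>" if "v \<in> S" for v
    using Imp.IH[OF that] Imp.prems(2) by (simp_all del: o_apply)
  show ?case
    unfolding forces.simps using IH up[OF Imp.prems(1)] zig[OF Imp.prems(1)] zag[OF Imp.prems(1)]
    by metis
next
  case (All x \<psi>)
  have upd: "map_option g \<circ> e(x \<mapsto> d) = (map_option g \<circ> e)(x \<mapsto> g d)" for d by auto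
  have IH: "forces M v (e(x \<mapsto> d)) \<psi> \<longleftrightarrow> forces N (f v) ((map_option g \<circ> e)(x \<mapsto> g d)) \<psi>"
    if "v \<in> S" for v d
  proof -
    have "free_vars \<psi> \<subseteq> Map.dom (e(x \<mapsto> d))" using All.prems(2) by auto
    from All.IH[OF that this] show ?thesis by (simp only: upd)
  qed
  show ?case
  proof
    assume l: "forces M w e (All x \<psi>)"
    show "forces N (f w) (map_option g \<circ> e) (All x \<psi>)"
      unfolding forces.simps
    proof (intro allI impI ballI)
      fix u d assume "(f w, u) \<in> worldord (frame_of N)" and d: "d \<in> domain (frame_of N) u"
      then obtain v where v: "(w, v) \<in> worldord (frame_of M)" "u = f v"
        using zag[OF All.prems(1)] by blast
      note vS = up[OF All.prems(1) v(1)]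
      obtain d' where "d = g d'" "d' \<in> domain (frame_of M) v"
        using d v(2) dom[OF vS] by auto
      with l v IH[OF vS, of d'] show "forces N u ((map_option g \<circ> e)(x \<mapsto> d)) \<psi>" by simp
    qed
  next
    assume r: "forces N (f w) (map_option g \<circ> e) (All x \<psi>)"
    show "forces M w e (All x \<psi>)"
      unfolding forces.simps
    proof (intro allI impI ballI)
      fix v d assume v: "(w, v) \<in> worldord (frame_of M)" and d: "d \<in> domain (frame_of M) v"
      note vS = up[OF All.prems(1) v]
      from r zig[OF All.prems(1) v] dom[OF vS] d
      have "forces N (f v) ((map_option g \<circ> e)(x \<mapsto> g d)) \<psi>" by simp
      with IH[OF vS] show "forces M v (e(x \<mapsto> d)) \<psi>" by blast
    qed
  qed
next
  case (Ex x \<psi>)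
  have upd: "map_option g \<circ> e(x \<mapsto> d) = (map_option g \<circ> e)(x \<mapsto> g d)" for d by auto
  have "forces M w (e(x \<mapsto> d)) \<psi> \<longleftrightarrow> forces N (f w) ((map_option g \<circ> e)(x \<mapsto> g d)) \<psi>" for d
  proof -
    have "free_vars \<psi> \<subseteq> Map.dom (e(x \<mapsto> d))" using Ex.prems(2) by auto
    from Ex.IH[OF Ex.prems(1) this] show ?thesis by (simp only: upd)
  qed
  then show ?case unfolding forces.simps dom[OF Ex.prems(1)] by blast
qed simp_all

text \<open>Unlike in \<open>consequence\<close>, the interpreted constants form an explicit set: an
  object already in the game must have a value in the models even while no formula claimed so far
  mentions it.\<close>

definition entails ::
  "('w, 'd) kframe set \<Rightarrow> 'a set \<Rightarrow> ('p, 'a) fm set \<Rightarrow> ('p, 'a) fm \<Rightarrow> bool" where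
  "entails X \<Delta> T \<psi> \<longleftrightarrow>
     (\<forall>M :: ('p, 'a, 'w, 'd) kmodel.
        kripke_model \<Delta> M \<longrightarrow> frame_of M \<in> X \<longrightarrow>
        (\<forall>\<chi> \<in> T. \<forall>w \<in> worlds (frame_of M). forces M w Map.empty \<chi>) \<longrightarrow>
        (\<forall>w \<in> worlds (frame_of M). forces M w Map.empty \<psi>))"

lemma entailsD:
  assumes "entails X \<Delta> T \<psi>" "kripke_model \<Delta> M" "frame_of M \<in> X"
    and "\<And>\<chi> v. \<chi> \<in> T \<Longrightarrow> v \<in> worlds (frame_of M) \<Longrightarrow> forces M v Map.empty \<chi>"
    and "w \<in> worlds (frame_of M)"
  shows "forces M w Map.empty \<psi>"
  using assms unfolding entails_def by blast

text \<open>More objects and more premises admit fewer models. Hence no move of Opponent turns an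
  earlier consequence into a non-consequence.\<close>

lemma entails_mono:
  fixes X :: "('w, 'd) kframe set" and \<psi> :: "('p, 'a) fm"
  assumes "entails X \<Delta> T \<psi>" "\<Delta> \<subseteq> \<Delta>'" "T \<subseteq> T'"
  shows "entails X \<Delta>' T' \<psi>"
proof -
  have "kripke_model \<Delta> M" if "kripke_model \<Delta>' M" for M :: "('p, 'a, 'w, 'd) kmodel"
    using that assms(2) unfolding kripke_model_def by blast
  with assms(1,3) show ?thesis unfolding entails_def by blast
qed

text \<open>An isomorphic copy if \<open>f\<close> and \<open>g\<close> are injective. Outside their
  ranges \<open>inv\<close> is arbitrary, which is harmless: the worlds and the individuals of the
  copy all lie in the ranges.\<close>

definition map_model ::
  "('v \<Rightarrow> 'w) \<Rightarrow> ('e \<Rightarrow> 'd) \<Rightarrow> ('p, 'a, 'v, 'e) kmodel \<Rightarrow> ('p, 'a, 'w, 'd) kmodel" where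
  "map_model f g M =
    \<lparr>frame_of = \<lparr>worlds = f ` worlds (frame_of M), worldord = map_prod f f ` worldord (frame_of M),
       domain = (\<lambda>w. g ` domain (frame_of M) (inv f w))\<rparr>,
     cinterp = g \<circ> cinterp M,
     pinterp = (\<lambda>w p ds. pinterp M (inv f w) p (map (inv g) ds))\<rparr>"

lemma map_model_simps:
  assumes "inj f"
  shows "worlds (frame_of (map_model f g M)) = f ` worlds (frame_of M)"
    and "(f w, f v) \<in> worldord (frame_of (map_model f g M)) \<longleftrightarrow> (w, v) \<in> worldord (frame_of M)"
    and "(w', v') \<in> worldord (frame_of (map_model f g M)) \<longleftrightarrow>
      (\<exists>w v. w' = f w \<and> v' = f v \<and> (w, v) \<in> worldord (frame_of M))"
    and "domain (frame_of (map_model f g M)) (f w) = g ` domain (frame_of M) w"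
    and "cinterp (map_model f g M) c = g (cinterp M c)"
    and "pinterp (map_model f g M) (f w) p ds = pinterp M w p (map (inv g) ds)"
  using assms by (auto simp: map_model_def inj_eq)

lemma forces_map_model:
  assumes "inj f" "inj g" "free_vars \<psi> \<subseteq> Map.dom e"
  shows "forces (map_model f g M) (f w) (map_option g \<circ> e) \<psi> \<longleftrightarrow> forces M w e \<psi>"
proof (rule forces_p_morphism[where S = UNIV, symmetric])
  show "\<exists>v. (w, v) \<in> worldord (frame_of M) \<and> u = f v"
    if "(f w, u) \<in> worldord (frame_of (map_model f g M))" for w u
    using that by (auto simp: map_model_simps(3)[OF assms(1)] inj_eq[OF assms(1)])
  have "map (inv g) (map g ds) = ds" for ds using assms(2) by simp
  then show "pinterp M w p ds \<longleftrightarrow> pinterp (map_model f g M) (f w) p (map g ds)" for w p ds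
    by (simp only: map_model_simps(6)[OF assms(1)])
qed (use assms in \<open>simp_all add: map_model_simps\<close>)

lemma kripke_frame_map_model:
  assumes "inj f" "kripke_frame (frame_of M)"
  shows "kripke_frame (frame_of (map_model f g M))" (is "kripke_frame ?F")
proof (rule kripke_frameI)
  note F = kripke_frameD[OF assms(2)]
  note s = map_model_simps[OF assms(1)]
  show "(w, w) \<in> worldord ?F" if "w \<in> worlds ?F" for w
    using that F(1) by (auto simp: s inj_eq[OF assms(1)])
  show "(x, z) \<in> worldord ?F" if xyz: "(x, y) \<in> worldord ?F" "(y, z) \<in> worldord ?F" for x y z
  proof -
    obtain u v w where "x = f u" "y = f v" "z = f w"
      "(u, v) \<in> worldord (frame_of M)" "(v, w) \<in> worldord (frame_of M)"
      using xyz by (auto simp: s(3) inj_eq[OF assms(1)])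
    with F(2) show ?thesis by (simp only: s(2))
  qed
  show "x = y" if xy: "(x, y) \<in> worldord ?F" "(y, x) \<in> worldord ?F" for x y
  proof -
    obtain u v where "x = f u" "y = f v"
      "(u, v) \<in> worldord (frame_of M)" "(v, u) \<in> worldord (frame_of M)"
      using xy by (auto simp: s(3) inj_eq[OF assms(1)])
    with F(3) show ?thesis by blast
  qed
  show "w \<in> worlds ?F \<and> v \<in> worlds ?F" if "(w, v) \<in> worldord ?F" for w v
    using that F(4) by (auto simp: s)
  show "domain ?F w' \<subseteq> domain ?F v'" if wv: "(w', v') \<in> worldord ?F" for w' v'
  proof -
    obtain w v where "w' = f w" "v' = f v" "(w, v) \<in> worldord (frame_of M)"
      using wv unfolding s(3) by blast
    with F(5)[of w v] show ?thesis by (simp only: s(4)) blast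
  qed
qed

lemma kripke_model_map_model:
  assumes "inj f" "inj g" "kripke_model \<Delta> M"
  shows "kripke_model \<Delta> (map_model f g M)"
proof -
  note s = map_model_simps[OF assms(1)]
  have "pinterp (map_model f g M) v' p ds"
    if *: "(w', v') \<in> worldord (frame_of (map_model f g M))"
      "set ds \<subseteq> domain (frame_of (map_model f g M)) w'" "pinterp (map_model f g M) w' p ds" for w' v' p ds
  proof -
    obtain w v where wv: "w' = f w" "v' = f v" "(w, v) \<in> worldord (frame_of M)"
      using *(1) unfolding s(3) by blast
    have "set (map (inv g) ds) \<subseteq> domain (frame_of M) w"
      using *(2) assms(2) unfolding wv(1) s(4) by auto
    with *(3) wv assms(3) show ?thesis
      unfolding wv s(6) kripke_model_def by blast
  qed
  moreover have "cinterp (map_model f g M) c \<in> domain (frame_of (map_model f g M)) w'"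
    if "c \<in> \<Delta>" "w' \<in> worlds (frame_of (map_model f g M))" for c w'
    using that assms(3) unfolding s(1) kripke_model_def by (auto simp: s(4,5))
  moreover have "kripke_frame (frame_of (map_model f g M))"
    by (rule kripke_frame_map_model[OF assms(1)]) (use assms(3) in \<open>simp add: kripke_model_def\<close>)
  ultimately show ?thesis unfolding kripke_model_def by blast
qed

lemma noetherian_map_model:
  assumes "inj f" "frame_of M \<in> noetherian_frames"
  shows "frame_of (map_model f g M) \<in> noetherian_frames"
proof -
  note s = map_model_simps[OF assms(1)]
  have False
    if t: "\<And>i. (t i, t (Suc i)) \<in> worldord (frame_of (map_model f g M)) \<and> t i \<noteq> t (Suc i)" for t
  proof -
    have "\<exists>w. t i = f w" for i using t[of i] unfolding s(3) by blast
    then obtain t' where t': "\<And>i. t i = f (t' i)" by metis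
    have "(t' i, t' (Suc i)) \<in> worldord (frame_of M) \<and> t' i \<noteq> t' (Suc i)" for i
      using t[of i] unfolding t' s(2) by auto
    with assms(2) show False unfolding noetherian_frames_def by blast
  qed
  moreover have "kripke_frame (frame_of (map_model f g M))"
    by (rule kripke_frame_map_model[OF assms(1)]) (use assms(2) in \<open>simp add: noetherian_frames_def\<close>)
  ultimately show ?thesis unfolding noetherian_frames_def by blast
qed

text \<open>A model over \<open>'v\<close> and \<open>'e\<close> is copied to one over
  \<open>'w\<close> and \<open>'d\<close>. Thus a consequence over the given types can be applied to
  the glued model, whose types are built with options, products and sums.\<close>

lemma entails_smaller_types:
  assumes "(UNIV :: 'v set) \<lesssim> (UNIV :: 'w set)" "(UNIV :: 'e set) \<lesssim> (UNIV :: 'd set)"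
    and ent: "entails (noetherian_frames :: ('w, 'd) kframe set) \<Delta> T \<psi>"
    and closed: "\<And>\<chi>. \<chi> \<in> insert \<psi> T \<Longrightarrow> free_vars \<chi> = {}"
  shows "entails (noetherian_frames :: ('v, 'e) kframe set) \<Delta> T \<psi>"
  unfolding entails_def
proof (intro allI impI ballI)
  fix M :: "(_, _, 'v, 'e) kmodel" and w
  assume M: "kripke_model \<Delta> M" "frame_of M \<in> noetherian_frames"
    and T: "\<forall>\<chi> \<in> T. \<forall>w \<in> worlds (frame_of M). forces M w Map.empty \<chi>"
    and w: "w \<in> worlds (frame_of M)"
  obtain f :: "'v \<Rightarrow> 'w" and g :: "'e \<Rightarrow> 'd" where fg: "inj f" "inj g"
    using assms(1,2) by (auto simp: lepoll_UNIV_iff_inj)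
  have forces: "forces (map_model f g M) (f v) Map.empty \<chi> \<longleftrightarrow> forces M v Map.empty \<chi>"
    if "\<chi> \<in> insert \<psi> T" for v \<chi>
    using forces_map_model[OF fg, of \<chi> Map.empty M v] closed[OF that] by (simp add: comp_def)
  have "forces (map_model f g M) (f w) Map.empty \<psi>"
  proof (rule entailsD[OF ent kripke_model_map_model[OF fg M(1)] noetherian_map_model[OF fg(1) M(2)]])
    show "forces (map_model f g M) v Map.empty \<chi>"
      if "\<chi> \<in> T" "v \<in> worlds (frame_of (map_model f g M))" for \<chi> v
      using that T forces by (auto simp: map_model_simps(1)[OF fg(1)])
  qed (simp add: map_model_simps(1)[OF fg(1)] w)
  then show "forces M w Map.empty \<psi>" using forces by simp
qed

section \<open>Gluing countermodels\<close>

text \<open>The models \<open>K \<chi>\<close>, for \<open>\<chi> \<in> I\<close>, are put side by side above a new root (the world \<open>None\<close>),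
  at which exactly the objects of \<open>\<Delta>\<close> exist and the atoms in \<open>T\<close> are true. As the models may
  interpret \<open>\<Delta>\<close> differently and not injectively, every object \<open>\<alpha>\<close> becomes an individual \<open>Inl \<alpha>\<close> of
  its own, which behaves in \<open>K \<chi>\<close> like the value of \<open>\<alpha>\<close> there.\<close>

definition glued_model ::
  "('p, 'a) fm set \<Rightarrow> 'a set \<Rightarrow> 'i set \<Rightarrow> ('i \<Rightarrow> ('p, 'a, 'w, 'd) kmodel) \<Rightarrow>
    ('p, 'a, ('i \<times> 'w) option, 'a + 'd) kmodel" where
  "glued_model T \<Delta> I K =
    \<lparr>frame_of =
      \<lparr>worlds = insert None (Some ` (SIGMA \<chi>:I. worlds (frame_of (K \<chi>)))),
       worldord = {None} \<times> insert None (Some ` (SIGMA \<chi>:I. worlds (frame_of (K \<chi>)))) \<union>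
         {(Some (\<chi>, v), Some (\<chi>, v')) | \<chi> v v'. \<chi> \<in> I \<and> (v, v') \<in> worldord (frame_of (K \<chi>))},
       domain = (\<lambda>u. Inl ` \<Delta> \<union>
         (case u of None \<Rightarrow> {} | Some (\<chi>, v) \<Rightarrow> Inr ` domain (frame_of (K \<chi>)) v))\<rparr>,
     cinterp = Inl,
     pinterp = (\<lambda>u p ds. case u of None \<Rightarrow> Atom p (map (Con \<circ> projl) ds) \<in> T
       | Some (\<chi>, v) \<Rightarrow> pinterp (K \<chi>) v p (map (case_sum (cinterp (K \<chi>)) id) ds))\<rparr>"

locale countermodels =
  fixes T :: "('p, 'a) fm set" and \<Delta> :: "'a set" and I :: "'i set"
    and K :: "'i \<Rightarrow> ('p, 'a, 'w, 'd) kmodel"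
  assumes models: "\<And>\<chi>. \<chi> \<in> I \<Longrightarrow> kripke_model \<Delta> (K \<chi>)"
    and noetherian: "\<And>\<chi>. \<chi> \<in> I \<Longrightarrow> frame_of (K \<chi>) \<in> noetherian_frames"
    and true: "\<And>\<chi> w \<psi>. \<chi> \<in> I \<Longrightarrow> w \<in> worlds (frame_of (K \<chi>)) \<Longrightarrow> \<psi> \<in> T \<Longrightarrow>
      forces (K \<chi>) w Map.empty \<psi>"
begin

abbreviation G :: "('p, 'a, ('i \<times> 'w) option, 'a + 'd) kmodel" where
  "G \<equiv> glued_model T \<Delta> I K"

lemma frames: "\<chi> \<in> I \<Longrightarrow> kripke_frame (frame_of (K \<chi>))"
  using models by (simp add: kripke_model_def)

lemma G_simps:
  "worlds (frame_of G) = insert None (Some ` (SIGMA \<chi>:I. worlds (frame_of (K \<chi>))))"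
  "(None, u) \<in> worldord (frame_of G) \<longleftrightarrow> u \<in> worlds (frame_of G)"
  "(u, None) \<in> worldord (frame_of G) \<longleftrightarrow> u = None"
  "(Some (\<chi>, v), u) \<in> worldord (frame_of G) \<longleftrightarrow>
    \<chi> \<in> I \<and> (\<exists>v'. u = Some (\<chi>, v') \<and> (v, v') \<in> worldord (frame_of (K \<chi>)))"
  "domain (frame_of G) None = Inl ` \<Delta>"
  "domain (frame_of G) (Some (\<chi>, v)) = Inl ` \<Delta> \<union> Inr ` domain (frame_of (K \<chi>)) v"
  "cinterp G = Inl"
  "pinterp G None p ds \<longleftrightarrow> Atom p (map (Con \<circ> projl) ds) \<in> T"
  "pinterp G (Some (\<chi>, v)) p ds \<longleftrightarrow> pinterp (K \<chi>) v p (map (case_sum (cinterp (K \<chi>)) id) ds)"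
  by (auto simp: glued_model_def)

text \<open>Each component interprets all of \<Delta>, so the added individuals
  \<open>Inl \<alpha>\<close> only duplicate individuals that exist there anyway.\<close>

lemma values_in_domain:
  assumes "\<chi> \<in> I" "v \<in> worlds (frame_of (K \<chi>))"
  shows "case_sum (cinterp (K \<chi>)) id ` (Inl ` \<Delta> \<union> Inr ` domain (frame_of (K \<chi>)) v) =
    domain (frame_of (K \<chi>)) v"
proof -
  have "cinterp (K \<chi>) ` \<Delta> \<subseteq> domain (frame_of (K \<chi>)) v"
    using models[OF assms(1)] assms(2) unfolding kripke_model_def by blast
  then show ?thesis by (auto simp: image_Un image_image)
qed

lemma frame_G: "kripke_frame (frame_of G)"
proof (rule kripke_frameI)
  show "(u, u) \<in> worldord (frame_of G)" if "u \<in> worlds (frame_of G)" for u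
    using that kripke_frameD(1)[OF frames] by (cases u) (auto simp: G_simps)
  show "(u, w) \<in> worldord (frame_of G)"
    if "(u, v) \<in> worldord (frame_of G)" "(v, w) \<in> worldord (frame_of G)" for u v w
  proof (cases u)
    case None
    then show ?thesis
      using that kripke_frameD(4)[OF frames] by (cases v) (auto simp: G_simps)
  next
    case (Some a)
    then show ?thesis
      using that kripke_frameD(2)[OF frames] by (cases a) (auto simp: G_simps)
  qed
  show "u = v" if "(u, v) \<in> worldord (frame_of G)" "(v, u) \<in> worldord (frame_of G)" for u v
    using that kripke_frameD(3)[OF frames] by (cases u; cases v) (auto simp: G_simps)
  show "u \<in> worlds (frame_of G) \<and> v \<in> worlds (frame_of G)"
    if "(u, v) \<in> worldord (frame_of G)" for u v
    using that kripke_frameD(4)[OF frames] by (cases u) (auto simp: G_simps)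
  show "domain (frame_of G) u \<subseteq> domain (frame_of G) v"
    if uv: "(u, v) \<in> worldord (frame_of G)" for u v
  proof (cases u)
    case None
    then show ?thesis by (cases v) (auto simp: G_simps)
  next
    case (Some a)
    then obtain \<chi> w w' where *: "u = Some (\<chi>, w)" "v = Some (\<chi>, w')" "\<chi> \<in> I"
      "(w, w') \<in> worldord (frame_of (K \<chi>))"
      using uv by (cases a) (auto simp: G_simps)
    from kripke_frameD(5)[OF frames *(4)] *(3) show ?thesis
      unfolding *(1,2) G_simps by blast
  qed
qed

lemma model_G: "kripke_model \<Delta> G"
proof -
  have "pinterp G v p ds"
    if uv: "(u, v) \<in> worldord (frame_of G)" and ds: "set ds \<subseteq> domain (frame_of G) u"
      and p: "pinterp G u p ds" for u v p ds
  proof (cases v)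
    case None
    then show ?thesis using uv p by (simp add: G_simps)
  next
    case (Some a)
    then obtain \<chi> v' where v: "v = Some (\<chi>, v')" by (cases a) auto
    show ?thesis
    proof (cases u)
      case None
      then have \<chi>: "\<chi> \<in> I" "v' \<in> worlds (frame_of (K \<chi>))"
        using uv v by (auto simp: G_simps)
      have "Atom p (map (Con \<circ> projl) ds) \<in> T" using p None by (simp add: G_simps)
      from true[OF \<chi> this]
      have "pinterp (K \<chi>) v' p (map (cinterp (K \<chi>) \<circ> projl) ds)" by (simp add: comp_def)
      \<comment> \<open>Only individuals of the form \<open>Inl \<alpha>\<close> exist at the root,
        so \<open>projl\<close> recovers the object behind each argument.\<close>
      moreover have "map (cinterp (K \<chi>) \<circ> projl) ds = map (case_sum (cinterp (K \<chi>)) id) ds"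
        using ds None by (auto simp: G_simps)
      ultimately show ?thesis by (simp add: v G_simps)
    next
      case (Some b)
      then obtain u' where u: "u = Some (\<chi>, u')" and *: "\<chi> \<in> I" "(u', v') \<in> worldord (frame_of (K \<chi>))"
        using uv v by (cases b) (auto simp: G_simps)
      have "set (map (case_sum (cinterp (K \<chi>)) id) ds) \<subseteq> domain (frame_of (K \<chi>)) u'"
        using ds values_in_domain[OF *(1)] kripke_frameD(4)[OF frames[OF *(1)] *(2)]
        by (simp add: u G_simps) blast
      with * p models[OF *(1)] show ?thesis
        unfolding u v G_simps kripke_model_def by blast
    qed
  qed
  moreover have "cinterp G c \<in> domain (frame_of G) u" if "c \<in> \<Delta>" for c u
    using that by (cases u) (auto simp: G_simps)
  ultimately show ?thesis using frame_G unfolding kripke_model_def by blast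
qed

lemma noetherian_G: "frame_of G \<in> noetherian_frames"
proof -
  have False if s: "\<And>i. (s i, s (Suc i)) \<in> worldord (frame_of G) \<and> s i \<noteq> s (Suc i)" for s
  proof -
    \<comment> \<open>Nothing lies below the root except itself, so only \<open>s 0\<close> can be
      the root; from index 1 on the chain stays in one component.\<close>
    have "s 1 \<noteq> None"
    proof
      assume None: "s 1 = None"
      then have "(s 0, None) \<in> worldord (frame_of G)" "s 0 \<noteq> None" using s[of 0] by simp_all
      then show False by (simp add: G_simps(3))
    qed
    then obtain \<chi> v where 1: "s 1 = Some (\<chi>, v)" by auto
    have \<chi>: "\<chi> \<in> I" using s[of 1] 1 by (simp add: G_simps)
    have "\<exists>v. s (Suc i) = Some (\<chi>, v)" for i
    proof (induction i)
      case 0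
      then show ?case using 1 by simp
    next
      case (Suc i)
      then show ?case using s[of "Suc i"] by (auto simp: G_simps)
    qed
    then obtain t where t: "\<And>i. s (Suc i) = Some (\<chi>, t i)" by metis
    have "(t i, t (Suc i)) \<in> worldord (frame_of (K \<chi>)) \<and> t i \<noteq> t (Suc i)" for i
      using s[of "Suc i"] t by (auto simp: G_simps)
    with noetherian[OF \<chi>] show False unfolding noetherian_frames_def by blast
  qed
  with frame_G show ?thesis unfolding noetherian_frames_def by blast
qed

text \<open>No arrow leaves a component, and projecting it to \<open>K \<chi>\<close>, with
  \<open>Inl \<alpha>\<close> sent to the value of \<alpha> there, is a bounded morphism.\<close>

lemma forces_G:
  assumes \<chi>: "\<chi> \<in> I" and v: "v \<in> worlds (frame_of (K \<chi>))" and \<psi>: "free_vars \<psi> = {}"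
  shows "forces G (Some (\<chi>, v)) Map.empty \<psi> \<longleftrightarrow> forces (K \<chi>) v Map.empty \<psi>"
proof -
  let ?S = "Some ` ({\<chi>} \<times> worlds (frame_of (K \<chi>)))"
  have "forces G (Some (\<chi>, v)) Map.empty \<psi> \<longleftrightarrow>
    forces (K \<chi>) ((snd \<circ> the) (Some (\<chi>, v))) (map_option (case_sum (cinterp (K \<chi>)) id) \<circ> Map.empty) \<psi>"
  proof (rule forces_p_morphism[where S = ?S])
    show "domain (frame_of (K \<chi>)) ((snd \<circ> the) w) =
        case_sum (cinterp (K \<chi>)) id ` domain (frame_of G) w" if "w \<in> ?S" for w
    proof -
      obtain v where v: "w = Some (\<chi>, v)" "v \<in> worlds (frame_of (K \<chi>))" using \<open>w \<in> ?S\<close> by auto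
      show ?thesis using values_in_domain[OF \<chi> v(2)] unfolding v(1) G_simps by simp
    qed
  next
    fix w u
    assume "w \<in> ?S" and u: "((snd \<circ> the) w, u) \<in> worldord (frame_of (K \<chi>))"
    then have "(w, Some (\<chi>, u)) \<in> worldord (frame_of G)" using \<chi> by (auto simp: G_simps)
    then show "\<exists>v. (w, v) \<in> worldord (frame_of G) \<and> u = (snd \<circ> the) v" by force
  qed (use \<chi> v \<psi> kripke_frameD(4)[OF frames[OF \<chi>]] in \<open>auto simp: G_simps\<close>)
  then show ?thesis by (simp add: comp_def)
qed

end

section \<open>Proponent's strategy of claiming all consequences\<close>

definition consequences ::
  "('w, 'd) kframe set \<Rightarrow> ('p, 'a) fm set \<Rightarrow> ('p, 'a) position \<Rightarrow> ('p, 'a) fm set" where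
  "consequences X \<Gamma> C = {\<psi> \<in> instances \<Gamma> (objs C). entails X (objs C) (opp C) \<psi>}"

text \<open>Countermodels exist for all instances outside \<open>pro C\<close> because
  \<open>pro C\<close> contains every consequence. They force all claims of both players, so a claim
  can fail in the glued model only at the root.\<close>

lemma opponent_moves_at_consequences:
  fixes C :: "('p, 'a) position"
  assumes small: "(UNIV :: (('p, 'a) fm \<times> 'w) option set) \<lesssim> (UNIV :: 'w set)"
      "(UNIV :: ('a + 'd) set) \<lesssim> (UNIV :: 'd set)"
    and named: "\<And>\<gamma>. \<gamma> \<in> \<Gamma> \<Longrightarrow> constants \<gamma> \<subseteq> objs C"
    and opp: "opp C \<subseteq> instances \<Gamma> (objs C)"
    and pro: "pro C = consequences (noetherian_frames :: ('w, 'd) kframe set) \<Gamma> C"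
  shows "to_move C = Opponent"
proof -
  let ?X = "noetherian_frames :: ('w, 'd) kframe set"
  define I where "I = instances \<Gamma> (objs C) - pro C"
  have "\<forall>\<chi> \<in> I. \<exists>M :: ('p, 'a, 'w, 'd) kmodel. kripke_model (objs C) M \<and> frame_of M \<in> ?X \<and>
      (\<forall>\<psi> \<in> opp C. \<forall>w \<in> worlds (frame_of M). forces M w Map.empty \<psi>) \<and>
      (\<exists>w \<in> worlds (frame_of M). \<not> forces M w Map.empty \<chi>)"
    unfolding I_def pro consequences_def entails_def by blast
  then obtain K :: "('p, 'a) fm \<Rightarrow> ('p, 'a, 'w, 'd) kmodel" where
    K: "\<And>\<chi>. \<chi> \<in> I \<Longrightarrow> kripke_model (objs C) (K \<chi>)" "\<And>\<chi>. \<chi> \<in> I \<Longrightarrow> frame_of (K \<chi>) \<in> ?X"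
    "\<And>\<chi> w \<psi>. \<chi> \<in> I \<Longrightarrow> w \<in> worlds (frame_of (K \<chi>)) \<Longrightarrow> \<psi> \<in> opp C \<Longrightarrow> forces (K \<chi>) w Map.empty \<psi>"
    and refuted: "\<And>\<chi>. \<chi> \<in> I \<Longrightarrow> \<exists>w \<in> worlds (frame_of (K \<chi>)). \<not> forces (K \<chi>) w Map.empty \<chi>"
    by metis
  interpret countermodels "opp C" "objs C" I K
    using K by unfold_locales
  have None: "None \<in> worlds (frame_of G)" by (simp add: G_simps)
  have closed: "free_vars \<psi> = {}" if "\<psi> \<in> instances \<Gamma> (objs C)" for \<psi>
    using closed_instances[OF that] .
  have above: "forces G (Some (\<chi>, v)) Map.empty \<psi>"
    if \<psi>: "\<psi> \<in> instances \<Gamma> (objs C)" "\<psi> \<in> opp C \<union> pro C" and \<chi>: "\<chi> \<in> I" "v \<in> worlds (frame_of (K \<chi>))"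
    for \<psi> \<chi> v
  proof -
    have "forces (K \<chi>) v Map.empty \<psi>"
    proof (cases "\<psi> \<in> opp C")
      case True
      then show ?thesis using true[OF \<chi>] by blast
    next
      case False
      then have "entails ?X (objs C) (opp C) \<psi>" using \<psi>(2) by (simp add: pro consequences_def)
      from entailsD[OF this models[OF \<chi>(1)] noetherian[OF \<chi>(1)] true[OF \<chi>(1)] \<chi>(2)]
      show ?thesis by blast
    qed
    then show ?thesis using forces_G[OF \<chi> closed[OF \<psi>(1)]] by simp
  qed
  have holds: "holds C \<psi> \<longleftrightarrow> forces G None Map.empty \<psi>" if "\<psi> \<in> instances \<Gamma> (objs C)" for \<psi>
  proof (rule holds_iff_forces[OF frame_G None, of _ \<Gamma>])
    fix p ts assume "Atom p ts \<in> instances \<Gamma> (objs C)"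
    then have "tm_vars t = {}" if "t \<in> set ts" for t using closed that by fastforce
    \<comment> \<open>A closed term is some \<open>Con \<alpha>\<close>, with value
      \<open>Inl \<alpha>\<close>; reading the name back gives the same term, so atoms at the root
      are literally Opponent's claims.\<close>
    then have "Con (projl (tm_value G Map.empty t)) = t" if "t \<in> set ts" for t
      using that by (cases t) (force simp: G_simps)+
    then have "map ((Con \<circ> projl) \<circ> tm_value G Map.empty) ts = ts"
      by (simp add: map_idI)
    then show "Atom p ts \<in> opp C \<longleftrightarrow> forces G None Map.empty (Atom p ts)"
      by (simp add: G_simps)
  next
    fix \<psi> assume \<psi>: "\<psi> \<in> instances \<Gamma> (objs C)" and f: "forces G None Map.empty \<psi>"
    show "\<psi> \<in> opp C \<union> pro C"
    proof (rule ccontr)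
      assume "\<psi> \<notin> opp C \<union> pro C"
      then have I: "\<psi> \<in> I" using \<psi> by (simp add: I_def)
      then obtain w where w: "w \<in> worlds (frame_of (K \<psi>))" "\<not> forces (K \<psi>) w Map.empty \<psi>"
        using refuted by blast
      \<comment> \<open>Each component is indexed by the formula it refutes: forced at the root,
        \<open>\<psi>\<close> would persist into its own countermodel.\<close>
      have "forces G (Some (\<psi>, w)) Map.empty \<psi>"
      proof (rule forces_persistent[OF _ _ f])
        show "kripke_model {} G" using model_G by (simp add: kripke_model_def)
        show "(None, Some (\<psi>, w)) \<in> worldord (frame_of G)" using I w(1) by (auto simp: G_simps)
        show "cinterp G ` constants \<psi> \<subseteq> domain (frame_of G) None"
          using constants_instances[OF \<psi>] named by (auto simp: G_simps)
      qed (simp_all add: closed[OF \<psi>])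
      with forces_G[OF I w(1) closed[OF \<psi>]] w(2) show False by simp
    qed
  next
    fix \<psi> u
    assume "\<psi> \<in> instances \<Gamma> (objs C)" "\<psi> \<in> opp C \<union> pro C" "(None, u) \<in> worldord (frame_of G)" "u \<noteq> None"
    then show "forces G u Map.empty \<psi>" using above by (auto simp: G_simps)
  qed (simp_all add: G_simps that)
  have "holds C \<psi>" if O: "mistakes Opponent C = {}" and \<psi>: "\<psi> \<in> pro C" for \<psi>
  proof -
    have inst: "\<psi> \<in> instances \<Gamma> (objs C)" and ent: "entails ?X (objs C) (opp C) \<psi>"
      using \<psi> by (simp_all add: pro consequences_def)
    have "forces G u Map.empty \<chi>" if "\<chi> \<in> opp C" "u \<in> worlds (frame_of G)" for \<chi> u
    proof -
      have \<chi>: "\<chi> \<in> instances \<Gamma> (objs C)" using opp that(1) by blast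
      show ?thesis
      proof (cases u)
        case None
        have "holds C \<chi>" using O that(1) by auto
        then show ?thesis using holds[OF \<chi>] None by simp
      next
        case (Some a)
        then show ?thesis using above[OF \<chi>] that by (auto simp: G_simps)
      qed
    qed
    \<comment> \<open>The consequence is now applied to the glued model itself, which has just been
      shown to force Opponent's claims at the root too.\<close>
    moreover have "entails (noetherian_frames :: ((('p, 'a) fm \<times> 'w) option, 'a + 'd) kframe set)
        (objs C) (opp C) \<psi>"
      by (rule entails_smaller_types[OF small ent]) (use closed inst opp in blast)
    ultimately have "forces G None Map.empty \<psi>"
      using entailsD[OF _ model_G noetherian_G _ None] by blast
    then show ?thesis using holds[OF inst] by simp
  qed
  then show ?thesis by (auto simp: to_move_def)
qed

text \<open>The strategy depends on the last position only. \<open>step\<close> isolates the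
  semantic content; what remains is an invariant of plays.\<close>

lemma consequences_strategy_wins:
  fixes \<Gamma> :: "('p, 'a) fm set" and X :: "('w, 'd) kframe set"
  defines "\<sigma> \<equiv> \<lambda>h. (last h)\<lparr>pro := consequences X \<Gamma> (last h)\<rparr>"
  assumes step: "\<And>C. (\<And>\<gamma>. \<gamma> \<in> \<Gamma> \<Longrightarrow> constants \<gamma> \<subseteq> objs C) \<Longrightarrow> opp C \<subseteq> instances \<Gamma> (objs C) \<Longrightarrow>
      pro C = consequences X \<Gamma> C \<Longrightarrow> to_move C = Opponent"
    and named: "\<And>\<gamma>. \<gamma> \<in> \<Gamma> \<Longrightarrow> constants \<gamma> \<subseteq> objs C\<^sub>0"
    and opp: "opp C\<^sub>0 \<subseteq> instances \<Gamma> (objs C\<^sub>0)"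
    and pro: "pro C\<^sub>0 \<subseteq> consequences X \<Gamma> C\<^sub>0"
  shows "proponent_winning_strategy \<Gamma> C\<^sub>0 \<sigma>"
  unfolding proponent_winning_strategy_def
proof (intro allI impI, elim conjE)
  fix h assume play: "play \<Gamma> C\<^sub>0 h" and follows: "follows Proponent \<sigma> h"
  \<comment> \<open>An inclusion rather than an equality for \<open>pro C\<close>: Opponent's moves
    create new consequences, which only the next move of Proponent adds.\<close>
  define inv where "inv C \<longleftrightarrow> (\<forall>\<gamma> \<in> \<Gamma>. constants \<gamma> \<subseteq> objs C) \<and> opp C \<subseteq> instances \<Gamma> (objs C) \<and>
    pro C \<subseteq> consequences X \<Gamma> C" for C
  have \<sigma>: "inv (\<sigma> g)" "to_move (\<sigma> g) = Opponent" if "inv (last g)" for g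
  proof -
    \<comment> \<open>Proponent's claims do not enter into the set of consequences, so adding all of
      it gives exactly the equality that \<open>step\<close> requires.\<close>
    have cons: "consequences X \<Gamma> (\<sigma> g) = consequences X \<Gamma> (last g)"
      by (simp add: \<sigma>_def consequences_def)
    then show "inv (\<sigma> g)" using that by (simp add: inv_def \<sigma>_def)
    show "to_move (\<sigma> g) = Opponent"
      by (rule step) (use that cons in \<open>auto simp: inv_def \<sigma>_def\<close>)
  qed
  have h: "h \<noteq> []" "h ! 0 = C\<^sub>0" using play by (auto simp: play_def hd_conv_nth)
  have last_take: "last (take (Suc i) h) = h ! i" if "i < length h" for i
    using that by (simp add: take_Suc_conv_app_nth)
  have inv: "inv (h ! i)" if "i < length h" for i
    using that
  proof (induction i)
    case 0
    show ?case unfolding h(2) inv_def using named opp pro by blast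
  next
    case (Suc i)
    then have IH: "inv (h ! i)" by simp
    show ?case
    proof (cases "to_move (h ! i)")
      case Proponent
      then have "h ! Suc i = \<sigma> (take (Suc i) h)" using follows Suc.prems by (simp add: follows_def)
      then show ?thesis using \<sigma>(1) IH last_take Suc.prems by simp
    next
      case Opponent
      have "legal_move \<Gamma> (h ! i) (h ! Suc i)" using play Suc.prems by (simp add: play_def)
      then have move: "pro (h ! Suc i) = pro (h ! i)" "objs (h ! i) \<subseteq> objs (h ! Suc i)"
        "opp (h ! i) \<subseteq> opp (h ! Suc i)"
        "opp (h ! Suc i) \<subseteq> opp (h ! i) \<union> instances \<Gamma> (objs (h ! Suc i))"
        using Opponent by (simp_all add: legal_move_def)
      note mono = instances_mono[OF move(2), of \<Gamma>]
      have "consequences X \<Gamma> (h ! i) \<subseteq> consequences X \<Gamma> (h ! Suc i)"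
        using mono entails_mono[OF _ move(2,3), of X] unfolding consequences_def by blast
      then show ?thesis using IH move mono unfolding inv_def by blast
    qed
  qed
  have "\<not> lost_by Proponent h"
  proof
    assume "lost_by Proponent h"
    then obtain i where i: "Suc i < length h" "to_move (h ! i) = Proponent" "to_move (h ! Suc i) = Proponent"
      by (auto simp: lost_by_def over_after_def)
    then have "h ! Suc i = \<sigma> (take (Suc i) h)" using follows by (simp add: follows_def)
    with i \<sigma>(2) inv[of i] last_take[of i] show False by simp
  qed
  moreover have "legal_move \<Gamma> (last h) (\<sigma> h)" if "to_move (last h) = Proponent"
  proof -
    have "inv (last h)" using inv[of "length h - 1"] h(1) by (simp add: last_conv_nth)
    then show ?thesis using that by (auto simp: legal_move_def inv_def \<sigma>_def consequences_def)
  qed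
  ultimately show "\<not> lost_by Proponent h \<and>
      (\<not> lost_by Opponent h \<and> to_move (last h) = Proponent \<longrightarrow> legal_move \<Gamma> (last h) (\<sigma> h))"
    by blast
qed

section \<open>Renaming constants\<close>

lemma free_vars_map_fm: "free_vars (map_fm id k \<psi>) = free_vars \<psi>"
proof -
  have "tm_vars (map_tm k t) = tm_vars t" for t by (cases t) auto
  then show ?thesis by (induction \<psi>) auto
qed

text \<open>Contravariant: renaming constants of formulas along \<open>k\<close> corresponds to
  pulling their interpretation back along \<open>k\<close>.\<close>

definition rename_model :: "('c \<Rightarrow> 'a) \<Rightarrow> ('p, 'a, 'w, 'd) kmodel \<Rightarrow> ('p, 'c, 'w, 'd) kmodel" where
  "rename_model k M = \<lparr>frame_of = frame_of M, cinterp = cinterp M \<circ> k, pinterp = pinterp M\<rparr>"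

lemma forces_map_fm: "forces M w e (map_fm id k \<psi>) \<longleftrightarrow> forces (rename_model k M) w e \<psi>"
proof -
  have "tm_value M e (map_tm k t) = tm_value (rename_model k M) e t" for e t
    by (cases t) (auto simp: rename_model_def)
  then have "map (tm_value M e) (map (map_tm k) ts) = map (tm_value (rename_model k M) e) ts" for e ts
    by simp
  moreover have "frame_of (rename_model k M) = frame_of M" "pinterp (rename_model k M) = pinterp M"
    by (simp_all add: rename_model_def)
  ultimately show ?thesis by (induction \<psi> arbitrary: w e) (simp_all del: map_map)
qed

text \<open>New objects and individuals share the type \<open>'d\<close>, so each individual of a
  countermodel can itself be introduced as an object. The size assumptions bound the formulas over
  objects by \<open>'d\<close> and hence by \<open>'w\<close>, so that copies of the glued models
  fit into \<open>'w\<close> and \<open>'d\<close>.\<close>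

theorem theorem1:
  fixes O\<^sub>0 :: "('p, 'c) fm set" and \<phi> :: "('p, 'c) fm"
    and \<Gamma> :: "('p, 'c) fm set" and \<Delta>\<^sub>0 :: "'c set"
    and C\<^sub>0 :: "('p, ('c, 'd) obj) position"
  assumes "infinite (UNIV :: 'd set)"
    and "(UNIV :: 'p set) \<lesssim> (UNIV :: 'd set)"
    and "(UNIV :: 'c set) \<lesssim> (UNIV :: 'd set)"
    and "(UNIV :: 'd set) \<lesssim> (UNIV :: 'w set)"
    and "\<forall>\<psi> \<in> O\<^sub>0. closed_fm \<psi>"
    and "closed_fm \<phi>"
    and "\<Gamma> = O\<^sub>0 \<union> {\<phi>}"
    and "\<Delta>\<^sub>0 = (\<Union>\<psi> \<in> \<Gamma>. constants \<psi>)"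
    and "C\<^sub>0 = \<lparr>opp = lift ` O\<^sub>0, pro = {lift \<phi>}, objs = Const ` \<Delta>\<^sub>0\<rparr>"
  shows "(\<exists>\<sigma>. proponent_winning_strategy (lift ` \<Gamma>) C\<^sub>0 \<sigma>) \<longleftrightarrow>
         O\<^sub>0 \<Turnstile>\<^bsub>(noetherian_frames :: ('w, 'd) kframe set)\<^esub> \<phi>"
proof -
  note \<Gamma> = assms(7) and \<Delta> = assms(8) and C = assms(9)
  have lift_instances: "lift \<psi> \<in> instances (lift ` \<Gamma>) D" if "\<psi> \<in> \<Gamma>"
    for \<psi> :: "('p, 'c) fm" and D :: "('c, 'd) obj set"
    using that assms(5,6) by (intro closed_in_instances) (auto simp: closed_fm_def free_vars_map_fm \<Gamma>)
  have lift_constants: "constants \<gamma> \<subseteq> Const ` \<Delta>\<^sub>0" if "\<gamma> \<in> lift ` \<Gamma>" for \<gamma> :: "('p, ('c, 'd) obj) fm"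
    using that unfolding \<Delta> by (force simp: fm.set_map)
  show ?thesis
  proof
    assume "\<exists>\<sigma>. proponent_winning_strategy (lift ` \<Gamma>) C\<^sub>0 \<sigma>"
    then obtain \<sigma> where win: "proponent_winning_strategy (lift ` \<Gamma>) C\<^sub>0 \<sigma>" by blast
    show "O\<^sub>0 \<Turnstile>\<^bsub>(noetherian_frames :: ('w, 'd) kframe set)\<^esub> \<phi>"
      unfolding consequence_def
    proof (intro allI impI ballI, rule ccontr)
      fix M :: "('p, 'c, 'w, 'd) kmodel" and w
      assume M: "kripke_model (\<Union>\<psi> \<in> O\<^sub>0 \<union> {\<phi>}. constants \<psi>) M" "frame_of M \<in> noetherian_frames"
        and true: "\<forall>\<psi> \<in> O\<^sub>0. \<forall>w \<in> worlds (frame_of M). forces M w Map.empty \<psi>"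
        and w: "w \<in> worlds (frame_of M)" and \<phi>: "\<not> forces M w Map.empty \<phi>"
      define N :: "('p, ('c, 'd) obj, 'w, 'd) kmodel" where
        "N = \<lparr>frame_of = frame_of M, cinterp = case_obj (cinterp M) id, pinterp = pinterp M\<rparr>"
      have frame_N: "frame_of N = frame_of M" by (simp add: N_def)
      have "rename_model Const N = M" by (simp add: rename_model_def N_def comp_def)
      then have forces_N: "forces N v Map.empty (lift \<psi>) \<longleftrightarrow> forces M v Map.empty \<psi>" for v \<psi>
        by (simp add: forces_map_fm)
      \<comment> \<open>Every individual \<open>d\<close> gets the name \<open>New d\<close>, in
        addition to any constants denoting it; new individuals at later worlds are the objects that
        Opponent introduces there.\<close>
      define A where "A v = Const ` \<Delta>\<^sub>0 \<union> New ` domain (frame_of M) v" for v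
      have const: "cinterp M ` \<Delta>\<^sub>0 \<subseteq> domain (frame_of M) v" if "v \<in> worlds (frame_of M)" for v
        using M(1) that unfolding kripke_model_def \<Gamma> \<Delta> by blast
      have frame: "kripke_frame (frame_of M)" using M(1) by (simp add: kripke_model_def)
      interpret object_model N "lift ` \<Gamma>" A
      proof
        show "kripke_model {} N" using M(1) by (simp add: kripke_model_def N_def)
        show "frame_of N \<in> noetherian_frames" using M(2) by (simp add: frame_N)
        show "cinterp N ` A v = domain (frame_of N) v" if "v \<in> worlds (frame_of N)" for v
          using that const[of v] by (auto simp: N_def A_def image_Un image_image)
        show "A v \<subseteq> A u" if "(v, u) \<in> worldord (frame_of N)" for v u
          using kripke_frameD(5)[OF frame, of v u] that by (auto simp: frame_N A_def)
        show "constants \<gamma> \<subseteq> A v" if "\<gamma> \<in> lift ` \<Gamma>" for v \<gamma>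
          using lift_constants[OF that] by (auto simp: A_def)
      qed
      have "\<not> proponent_winning_strategy (lift ` \<Gamma>) C\<^sub>0 \<sigma>"
      proof (rule refuted_not_winning)
        show "objs C\<^sub>0 \<subseteq> A w" by (simp add: C A_def)
        show "opp C\<^sub>0 \<subseteq> {\<psi> \<in> instances (lift ` \<Gamma>) (A w). forces N w Map.empty \<psi>}"
          using true w lift_instances by (auto simp: C \<Gamma> forces_N)
        show "pro C\<^sub>0 \<subseteq> instances (lift ` \<Gamma>) (objs C\<^sub>0)"
          using lift_instances by (simp add: C \<Gamma>)
        show "refutes w (pro C\<^sub>0)"
          using w \<phi> by (simp add: refutes_def C forces_N frame_N)
      qed
      with win show False by blast
    qed
  next
    assume cons: "O\<^sub>0 \<Turnstile>\<^bsub>(noetherian_frames :: ('w, 'd) kframe set)\<^esub> \<phi>"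
    let ?X = "noetherian_frames :: ('w, 'd) kframe set"
    have obj: "(UNIV :: ('c, 'd) obj set) \<lesssim> (UNIV :: 'd set)"
      by (rule obj_lepoll[OF assms(1,3)])
    have "(UNIV :: ('p, ('c, 'd) obj) fm set) \<lesssim> (UNIV :: 'd set)"
      by (rule fm_lepoll[OF assms(1,2) obj])
    then have fm: "(UNIV :: ('p, ('c, 'd) obj) fm set) \<lesssim> (UNIV :: 'w set)"
      using assms(4) by (rule lepoll_trans)
    have "infinite (UNIV :: 'w set)"
      using assms(1,4) by (meson infinite_le_lepoll lepoll_trans)
    then have worlds: "(UNIV :: (('p, ('c, 'd) obj) fm \<times> 'w) option set) \<lesssim> (UNIV :: 'w set)"
      using fm by (rule option_prod_lepoll)
    have individuals: "(UNIV :: (('c, 'd) obj + 'd) set) \<lesssim> (UNIV :: 'd set)"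
      by (rule sum_lepoll[OF assms(1) obj lepoll_refl])
    \<comment> \<open>At the start the objects are exactly the constants of the language that occur,
      so a model over objects restricts to a model for \<open>consequence\<close>.\<close>
    have "entails ?X (objs C\<^sub>0) (opp C\<^sub>0) (lift \<phi>)"
      unfolding entails_def
    proof (intro allI impI ballI)
      fix M :: "('p, ('c, 'd) obj, 'w, 'd) kmodel" and w
      assume M: "kripke_model (objs C\<^sub>0) M" "frame_of M \<in> ?X"
        and true: "\<forall>\<chi> \<in> opp C\<^sub>0. \<forall>w \<in> worlds (frame_of M). forces M w Map.empty \<chi>"
        and w: "w \<in> worlds (frame_of M)"
      have frame: "frame_of (rename_model Const M) = frame_of M" by (simp add: rename_model_def)
      have "kripke_model (\<Union>\<psi> \<in> O\<^sub>0 \<union> {\<phi>}. constants \<psi>) (rename_model Const M)"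
        using M(1) unfolding \<Gamma>[symmetric] \<Delta>[symmetric]
        by (simp add: kripke_model_def rename_model_def C)
      moreover have "\<forall>\<psi> \<in> O\<^sub>0. \<forall>w \<in> worlds (frame_of M). forces (rename_model Const M) w Map.empty \<psi>"
        using true by (simp add: C forces_map_fm)
      ultimately have "forces (rename_model Const M) w Map.empty \<phi>"
        using cons M(2) w frame unfolding consequence_def by metis
      then show "forces M w Map.empty (lift \<phi>)" by (simp add: forces_map_fm)
    qed
    then have pro: "pro C\<^sub>0 \<subseteq> consequences ?X (lift ` \<Gamma>) C\<^sub>0"
      using lift_instances by (simp add: consequences_def C \<Gamma>)
    have opp: "opp C\<^sub>0 \<subseteq> instances (lift ` \<Gamma>) (objs C\<^sub>0)"
      using lift_instances by (auto simp: C \<Gamma>)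
    have named: "constants \<gamma> \<subseteq> objs C\<^sub>0" if "\<gamma> \<in> lift ` \<Gamma>" for \<gamma>
      using lift_constants[OF that] by (simp add: C)
    show "\<exists>\<sigma>. proponent_winning_strategy (lift ` \<Gamma>) C\<^sub>0 \<sigma>"
    proof
      show "proponent_winning_strategy (lift ` \<Gamma>) C\<^sub>0
          (\<lambda>h. (last h)\<lparr>pro := consequences ?X (lift ` \<Gamma>) (last h)\<rparr>)"
        using opponent_moves_at_consequences[OF worlds individuals] named opp pro
        by (rule consequences_strategy_wins)
    qed
  qed
qed

end
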